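(* Let $\ell\ge2$ be an integer and $\epsilon>0$. In the value oracle model, there exist instances of the problem $\max\{f(S):S\in\mathcal{B}\}$, where $f$ is a nonnegative submodular function and $\mathcal{B}$ is the collection of bases of a matroid with fractional base packing number $\nu=\ell/(\ell-1)$, such that any $(1-e^{-1/\ell}+\epsilon)$-approximation algorithm for these instances requires exponentially many value queries.
   Context: $f$ is submodular: $f(S\cup T)+f(S\cap T)\le f(S)+f(T)$; in the value oracle model the algorithm accesses $f$ only via queries returning $f(S)$. The fractional base packing number of a matroid with base family $\mathcal{B}$ is $\max\{\sum_{B\in\mathcal{B}}\lambda_B:\sum_{B}\lambda_B\mathbf{1}_B\le\mathbf{1},\lambda\ge0\}$. *)

theory Defs
  imports "HOL-Probability.Probability"
begin

definition matroid :: "'a set \<Rightarrow> 'a set set \<Rightarrow> bool" where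
  "matroid E \<I> \<longleftrightarrow> finite E \<and> \<I> \<subseteq> Pow E \<and> {} \<in> \<I> \<and>
     (\<forall>X\<in>\<I>. \<forall>Y. Y \<subseteq> X \<longrightarrow> Y \<in> \<I>) \<and>
     (\<forall>X\<in>\<I>. \<forall>Y\<in>\<I>. card X < card Y \<longrightarrow> (\<exists>y\<in>Y - X. insert y X \<in> \<I>))"

definition bases :: "'a set set \<Rightarrow> 'a set set" where
  "bases \<I> = {B \<in> \<I>. \<forall>X\<in>\<I>. B \<subseteq> X \<longrightarrow> X = B}"

definition fractional_packing :: "'a set \<Rightarrow> 'a set set \<Rightarrow> ('a set \<Rightarrow> real) \<Rightarrow> bool" where
  "fractional_packing E \<B> w \<longleftrightarrow> (\<forall>B\<in>\<B>. 0 \<le> w B) \<and>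
     (\<forall>e\<in>E. (\<Sum>B\<in>\<B>. w B * indicator B e) \<le> 1)"

(* A relation rather than a function, so that the maximum is really attained: in a matroid of
   rank 0 the linear program is unbounded and no \<nu> is related. *)
definition fractional_base_packing_number :: "'a set \<Rightarrow> 'a set set \<Rightarrow> real \<Rightarrow> bool" where
  "fractional_base_packing_number E \<B> \<nu> \<longleftrightarrow>
     (\<exists>w. fractional_packing E \<B> w \<and> (\<Sum>B\<in>\<B>. w B) = \<nu>) \<and>
     (\<forall>w. fractional_packing E \<B> w \<longrightarrow> (\<Sum>B\<in>\<B>. w B) \<le> \<nu>)"

definition submodular_on :: "'a set \<Rightarrow> ('a set \<Rightarrow> real) \<Rightarrow> bool" where
  "submodular_on E f \<longleftrightarrow>
     (\<forall>S T. S \<subseteq> E \<longrightarrow> T \<subseteq> E \<longrightarrow> f (S \<union> T) + f (S \<inter> T) \<le> f S + f T)"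

record inst =
  ground :: "nat set"
  indep :: "nat set set"
  objective :: "nat set \<Rightarrow> real"

definition valid_instance :: "real \<Rightarrow> inst \<Rightarrow> bool" where
  "valid_instance \<nu> I \<longleftrightarrow> matroid (ground I) (indep I) \<and>
     fractional_base_packing_number (ground I) (bases (indep I)) \<nu> \<and>
     submodular_on (ground I) (objective I) \<and>
     (\<forall>S. S \<subseteq> ground I \<longrightarrow> 0 \<le> objective I S)"

definition opt :: "inst \<Rightarrow> real" where
  "opt I = Max (objective I ` bases (indep I))"

(* A deterministic adaptive algorithm: Query S k asks for the value of S and continues with k
   applied to the answer. There is no bound on internal computation. *)
datatype query_tree = Output "nat set" | Query "nat set" "real \<Rightarrow> query_tree"

primrec result :: "(nat set \<Rightarrow> real) \<Rightarrow> query_tree \<Rightarrow> nat set" where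
  "result f (Output S) = S"
| "result f (Query S k) = result f (k (f S))"

primrec queries :: "(nat set \<Rightarrow> real) \<Rightarrow> query_tree \<Rightarrow> nat set list" where
  "queries f (Output S) = []"
| "queries f (Query S k) = S # queries f (k (f S))"

(* A randomized algorithm is a distribution over query trees. It is given the matroid
   explicitly, so that only access to the objective is restricted to oracle queries. *)
type_synonym algorithm = "nat set \<Rightarrow> nat set set \<Rightarrow> query_tree pmf"

definition run_on :: "algorithm \<Rightarrow> inst \<Rightarrow> query_tree pmf" where
  "run_on A I = A (ground I) (indep I)"

definition approximation_algorithm :: "real \<Rightarrow> inst set \<Rightarrow> algorithm \<Rightarrow> bool" where
  "approximation_algorithm \<alpha> \<F> A \<longleftrightarrow> (\<forall>I\<in>\<F>.
     (\<forall>t\<in>set_pmf (run_on A I).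
        set (queries (objective I) t) \<subseteq> Pow (ground I) \<and>
        result (objective I) t \<in> bases (indep I)) \<and>
     \<alpha> * opt I \<le> measure_pmf.expectation (run_on A I)
                   (\<lambda>t. objective I (result (objective I) t)))"

(* Worst case over the instances of \<F> of size n and over the internal randomness. *)
definition needs_queries :: "algorithm \<Rightarrow> inst set \<Rightarrow> nat \<Rightarrow> real \<Rightarrow> bool" where
  "needs_queries A \<F> n q \<longleftrightarrow> (\<exists>I\<in>\<F>. card (ground I) = n \<and>
     (\<exists>t\<in>set_pmf (run_on A I). q \<le> real (length (queries (objective I) t))))"

end

theory Submission
  imports Defs
begin

text \<open>
  The ground set consists of m blocks of R elements (the part A) and m blocks of l elements (the
  part B); bases contain m elements of A and (l - 1) m elements of B. The hidden data are a
  transversal C of the blocks of A and a transversal D of the blocks of B. With P and V the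
  deviations of a set from meeting C and D in the proportionate amount, y its (scaled) mass in A
  and z the fraction of B that it leaves free, put
  F = z - exp (P - y) (z - P (z + V)) and G = z (1 - exp (- y)).
  On bases G is (1 - exp (- 1 / l)) / l up to small errors, while F is nearly 1 / l on the base that
  consists of C and the complement of D.
  Since F - G vanishes to second order where P = V = 0, it can be multiplied by a cutoff that is 0
  near P = V = 0, equals almost 1 at unit distance and varies on a logarithmic scale; this changes
  the mixed second derivatives by O(1 / \<Lambda>) only, which a small concave term compensates. The
  resulting objective is submodular and agrees with a symmetric one, in which C and D do not occur,
  on every set that meets C and D proportionately. By a Chernoff bound a fixed set does so for all
  but an exponentially small fraction of the choices of C and D. An algorithm with fewer
  than exponentially many queries therefore behaves, for most choices, as on the symmetric objective.
\<close>

section \<open>Mixed second derivatives and submodularity\<close>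

text \<open>With \<open>w = 1 - b\<close>, \<open>F\<close> reads z (1 - exp (P - y)) + exp (P - y)
  P w: the mass \<open>y - P\<close>, mostly outside \<open>C\<close>, acts on \<open>z\<close> like
  coverage, while the deviation towards \<open>C\<close> pays linearly in \<open>w\<close>.
  Submodularity becomes a statement about four densities: an element raises one of them by
  \<open>1 / real m\<close>, so mixed second differences along any two coordinate directions, equal
  ones included, must be nonpositive. The obstacle is exact symmetry. Random transversals are only
  approximately balanced, so the objective must equal the symmetric one on a whole neighbourhood of
  P = V = 0. At distance r a cutoff over a bounded ratio of scales has second derivatives of order 1
  / r^2, which against F - G = O(r^2) leaves a constant error; spreading it over \<Lambda> units of
  the logarithm divides that error by \<Lambda>. The price is a radius \<eta> of about exp (-
  \<Lambda> / 2), harmless because it is independent of \<open>m\<close>. The order of choice is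
  therefore \<theta> from \<epsilon>, \<open>R\<close> from \<open>l\<close> and \<theta>, \<Lambda>
  from all of these, \<eta> from \<Lambda>, and \<open>m\<close> last.\<close>

definition mixed_jet ::
  "(real \<Rightarrow> real \<Rightarrow> real) \<Rightarrow> (real \<Rightarrow> real \<Rightarrow> real) \<Rightarrow> (real \<Rightarrow> real \<Rightarrow> real) \<Rightarrow> (real \<Rightarrow> real \<Rightarrow> real) \<Rightarrow> bool"
  where "mixed_jet f f1 f2 f12 \<longleftrightarrow> (\<forall>s t.
     ((\<lambda>s. f s t) has_real_derivative f1 s t) (at s) \<and>
     ((\<lambda>t. f s t) has_real_derivative f2 s t) (at t) \<and>
     ((\<lambda>t. f1 s t) has_real_derivative f12 s t) (at t))"

lemma mixed_jet_cong:
  assumes "mixed_jet f f1 f2 f12"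
    and "\<And>s t. f s t = g s t" "\<And>s t. f1 s t = g1 s t" "\<And>s t. f2 s t = g2 s t"
      "\<And>s t. f12 s t = g12 s t"
  shows "mixed_jet g g1 g2 g12"
proof -
  have "f = g" "f1 = g1" "f2 = g2" "f12 = g12" using assms(2-) by blast+
  then show ?thesis using assms(1) by simp
qed

lemma mixed_jet_affine: "mixed_jet (\<lambda>s t. x + s * d + t * e) (\<lambda>_ _. d) (\<lambda>_ _. e) (\<lambda>_ _. 0)"
  unfolding mixed_jet_def by (auto intro!: derivative_eq_intros)

lemma mixed_jet_add:
  assumes "mixed_jet f f1 f2 f12" "mixed_jet g g1 g2 g12"
  shows "mixed_jet (\<lambda>s t. f s t + g s t) (\<lambda>s t. f1 s t + g1 s t) (\<lambda>s t. f2 s t + g2 s t)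
           (\<lambda>s t. f12 s t + g12 s t)"
  using assms unfolding mixed_jet_def by (auto intro!: DERIV_add)

lemma mixed_jet_diff:
  assumes "mixed_jet f f1 f2 f12" "mixed_jet g g1 g2 g12"
  shows "mixed_jet (\<lambda>s t. f s t - g s t) (\<lambda>s t. f1 s t - g1 s t) (\<lambda>s t. f2 s t - g2 s t)
           (\<lambda>s t. f12 s t - g12 s t)"
  using assms unfolding mixed_jet_def by (auto intro!: DERIV_diff)

text \<open>The cross terms \<open>f1 * g2\<close> and \<open>f2 * g1\<close> are the reason for
  carrying the partial in the second variable inside the jet.\<close>

lemma mixed_jet_mult:
  assumes "mixed_jet f f1 f2 f12" "mixed_jet g g1 g2 g12"
  shows "mixed_jet (\<lambda>s t. f s t * g s t) (\<lambda>s t. f1 s t * g s t + f s t * g1 s t)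
           (\<lambda>s t. f2 s t * g s t + f s t * g2 s t)
           (\<lambda>s t. f12 s t * g s t + f1 s t * g2 s t + f2 s t * g1 s t + f s t * g12 s t)"
proof -
  have f: "((\<lambda>s. f s t) has_real_derivative f1 s t) (at s)"
      "(f s has_real_derivative f2 s t) (at t)" "(f1 s has_real_derivative f12 s t) (at t)" for s t
    using assms(1) unfolding mixed_jet_def by auto
  have g: "((\<lambda>s. g s t) has_real_derivative g1 s t) (at s)"
      "(g s has_real_derivative g2 s t) (at t)" "(g1 s has_real_derivative g12 s t) (at t)" for s t
    using assms(2) unfolding mixed_jet_def by auto
  show ?thesis
    unfolding mixed_jet_def
  proof (intro allI conjI)
    fix s t
    show "((\<lambda>s. f s t * g s t) has_real_derivative f1 s t * g s t + f s t * g1 s t) (at s)"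
      using DERIV_mult[OF f(1) g(1)]
      by (simp add: algebra_simps)
    show "((\<lambda>t. f s t * g s t) has_real_derivative f2 s t * g s t + f s t * g2 s t) (at t)"
      using DERIV_mult[OF f(2) g(2)]
      by (simp add: algebra_simps)
    have "((\<lambda>t. f1 s t * g s t) has_real_derivative f12 s t * g s t + g2 s t * f1 s t) (at t)"
      using DERIV_mult[OF f(3) g(2)]
      by (simp add: algebra_simps)
    moreover have "((\<lambda>t. f s t * g1 s t) has_real_derivative f2 s t * g1 s t + g12 s t * f s t) (at t)"
      using DERIV_mult[OF f(2) g(3)]
      by (simp add: algebra_simps)
    ultimately show "((\<lambda>t. f1 s t * g s t + f s t * g1 s t) has_real_derivative
        f12 s t * g s t + f1 s t * g2 s t + f2 s t * g1 s t + f s t * g12 s t) (at t)"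
      by (auto dest: DERIV_add simp: algebra_simps)
  qed
qed

lemma mixed_jet_compose:
  assumes jet: "mixed_jet f f1 f2 f12"
    and d1: "\<And>s t. (\<phi> has_real_derivative \<phi>1 (f s t)) (at (f s t))"
    and d2: "\<And>s t. (\<phi>1 has_real_derivative \<phi>2 (f s t)) (at (f s t))"
  shows "mixed_jet (\<lambda>s t. \<phi> (f s t)) (\<lambda>s t. \<phi>1 (f s t) * f1 s t) (\<lambda>s t. \<phi>1 (f s t) * f2 s t)
           (\<lambda>s t. \<phi>2 (f s t) * f1 s t * f2 s t + \<phi>1 (f s t) * f12 s t)"
proof -
  have f: "((\<lambda>s. f s t) has_real_derivative f1 s t) (at s)"
      "(f s has_real_derivative f2 s t) (at t)" "(f1 s has_real_derivative f12 s t) (at t)" for s t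
    using jet unfolding mixed_jet_def by auto
  show ?thesis
    unfolding mixed_jet_def
  proof (intro allI conjI)
    fix s t
    show "((\<lambda>s. \<phi> (f s t)) has_real_derivative \<phi>1 (f s t) * f1 s t) (at s)"
      using DERIV_chain2[OF d1 f(1)] .
    show "((\<lambda>t. \<phi> (f s t)) has_real_derivative \<phi>1 (f s t) * f2 s t) (at t)"
      using DERIV_chain2[OF d1 f(2)] .
    show "((\<lambda>t. \<phi>1 (f s t) * f1 s t) has_real_derivative
        \<phi>2 (f s t) * f1 s t * f2 s t + \<phi>1 (f s t) * f12 s t) (at t)"
      using DERIV_mult[OF DERIV_chain2[OF d2 f(2)] f(3)] by (simp add: algebra_simps)
  qed
qed

text \<open>Two monotonicity steps: \<open>f12 \<le> 0\<close> makes \<open>f1 s\<close>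
  nonincreasing, hence \<open>f s h - f s 0\<close> has nonpositive derivative in \<open>s\<close>.
  Derivatives exist globally, but the sign is asked for on the square only, since the box estimates
  hold only there.\<close>

lemma second_difference_nonpos:
  assumes jet: "mixed_jet f f1 f2 f12" and h: "0 \<le> h"
    and neg: "\<And>s t. \<lbrakk>0 \<le> s; s \<le> h; 0 \<le> t; t \<le> h\<rbrakk> \<Longrightarrow> f12 s t \<le> 0"
  shows "f h h + f 0 0 \<le> f h 0 + f 0 h"
proof -
  note f = jet[unfolded mixed_jet_def, rule_format]
  have f1: "f1 s h \<le> f1 s 0" if "0 \<le> s" "s \<le> h" for s
    by (rule DERIV_nonpos_imp_nonincreasing[OF h]) (use f neg that in blast)
  have "f h h - f h 0 \<le> f 0 h - f 0 0"
    by (rule DERIV_nonpos_imp_nonincreasing[OF h, of "\<lambda>s. f s h - f s 0"])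
      (use f f1 in \<open>auto intro!: exI[of _ "f1 _ h - f1 _ 0"] DERIV_diff\<close>)
  then show ?thesis by simp
qed

text \<open>Applied with \<open>n = 3\<close> and \<open>n = 2\<close>: the cutoff is the cube of a
  positive part so that it is twice differentiable across its kink, its first derivative being a
  multiple of the square.\<close>

lemma DERIV_pos_part_power:
  fixes u :: real
  assumes "2 \<le> n"
  shows "((\<lambda>u. (max 0 u) ^ n) has_real_derivative real n * (max 0 u) ^ (n - 1)) (at u)"
proof -
  consider "u < 0" | "u = 0" | "0 < u" by linarith
  then show ?thesis
  proof cases
    case 1
    have "((\<lambda>u::real. 0) has_real_derivative 0) (at u)" by simp
    then have "((\<lambda>u. (max 0 u) ^ n) has_real_derivative 0) (at u)"
      by (rule has_field_derivative_transform_within_open[where S = "{..<0}"])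
        (use 1 assms in \<open>auto simp: max_def\<close>)
    moreover have "real n * (max 0 u) ^ (n - 1) = 0" using 1 assms by simp
    ultimately show ?thesis by (simp only:)
  next
    case 2
    have "((\<lambda>h::real. (max 0 h) ^ n / h) \<longlongrightarrow> 0) (at 0)"
    proof (rule Lim_null_comparison)
      have "norm ((max 0 h) ^ n / h) \<le> \<bar>h\<bar>" if "\<bar>h\<bar> < 1" for h :: real
      proof (cases "h \<le> 0")
        case True
        then have "max 0 h ^ n = 0" using assms by simp
        then show ?thesis by (simp only: div_0 norm_zero abs_ge_zero)
      next
        case False
        then have "h ^ n \<le> h ^ 2"
          using that assms by (intro power_decreasing) auto
        then show ?thesis using False
          by (simp add: max_def divide_le_eq power2_eq_square)
      qed
      then show "\<forall>\<^sub>F h in at 0. norm ((max 0 h) ^ n / h) \<le> \<bar>h\<bar>"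
        by (auto simp: eventually_at intro!: exI[of _ 1])
      show "((\<lambda>h::real. \<bar>h\<bar>) \<longlongrightarrow> 0) (at 0)"
        by (auto intro!: tendsto_eq_intros)
    qed
    moreover have "(0::real) ^ n = 0" "(0::real) ^ (n - 1) = 0" using assms by auto
    ultimately show ?thesis unfolding 2 DERIV_def by (simp only: max.idem add_0_left diff_zero mult_zero_right)
  next
    case 3
    have "((\<lambda>u::real. u ^ n) has_real_derivative real n * u ^ (n - 1)) (at u)"
      by (auto intro!: derivative_eq_intros)
    then have "((\<lambda>u. (max 0 u) ^ n) has_real_derivative real n * u ^ (n - 1)) (at u)"
      by (rule has_field_derivative_transform_within_open[where S = "{0<..}"])
        (use 3 in \<open>auto simp: max_def\<close>)
    moreover have "max 0 u = u" using 3 by simp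
    ultimately show ?thesis by (simp only:)
  qed
qed

text \<open>Diminishing returns spread from pairs of elements by two inductions: \<open>marg\<close>
  enlarges the set that receives one element, \<open>add\<close> then enlarges the set that is
  added. The claim is \<open>add\<close> over the base \<open>S \<inter> T\<close> with increments
  \<open>S - T\<close> and \<open>T - S\<close>.\<close>

lemma submodular_on_local:
  assumes fin: "finite E"
    and loc: "\<And>S e e'. \<lbrakk>S \<subseteq> E; e \<in> E - S; e' \<in> E - S; e \<noteq> e'\<rbrakk> \<Longrightarrow>
       f (insert e (insert e' S)) + f S \<le> f (insert e S) + f (insert e' S)"
  shows "submodular_on E f"
proof -
  have marg: "f (insert e (X \<union> U)) - f (X \<union> U) \<le> f (insert e X) - f X"
    if "X \<union> U \<subseteq> E" "e \<in> E" "e \<notin> X \<union> U" for X U e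
  proof -
    have "finite U" using that fin finite_subset by blast
    then show ?thesis using that
    proof (induction U)
      case empty
      then show ?case by simp
    next
      case (insert u U)
      show ?case
      proof (cases "u \<in> X \<union> U")
        case True
        then have "X \<union> insert u U = X \<union> U" by blast
        then show ?thesis using insert by auto
      next
        case False
        have "f (insert e (insert u (X \<union> U))) + f (X \<union> U) \<le> f (insert e (X \<union> U)) + f (insert u (X \<union> U))"
          using insert.prems False by (intro loc) auto
        then show ?thesis using insert by auto
      qed
    qed
  qed
  have add: "f (X \<union> U \<union> W) - f (X \<union> U) \<le> f (X \<union> W) - f X"
    if "X \<union> U \<union> W \<subseteq> E" "W \<inter> (X \<union> U) = {}" for X U W
  proof -
    have "finite W" using that fin finite_subset by blast
    then show ?thesis using that
    proof (induction W)
      case empty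
      then show ?case by simp
    next
      case (insert v W)
      have "f (insert v (X \<union> W \<union> U)) - f (X \<union> W \<union> U) \<le> f (insert v (X \<union> W)) - f (X \<union> W)"
        using insert by (intro marg) auto
      moreover have "X \<union> W \<union> U = X \<union> U \<union> W" by blast
      ultimately show ?case using insert by auto
    qed
  qed
  show ?thesis
    unfolding submodular_on_def
  proof (intro allI impI)
    fix S T assume "S \<subseteq> E" "T \<subseteq> E"
    then have "f (S \<inter> T \<union> (S - T) \<union> (T - S)) - f (S \<inter> T \<union> (S - T))
        \<le> f (S \<inter> T \<union> (T - S)) - f (S \<inter> T)"
      by (intro add) auto
    moreover have "S \<inter> T \<union> (S - T) \<union> (T - S) = S \<union> T" "S \<inter> T \<union> (S - T) = S"
      "S \<inter> T \<union> (T - S) = T"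
      by auto
    ultimately show "f (S \<union> T) + f (S \<inter> T) \<le> f S + f T" by simp
  qed
qed

section \<open>The functions F, G and their interpolation\<close>

locale symmetry_gap =
  fixes l R :: nat and \<theta> \<Lambda> :: real
  assumes l_ge2: "2 \<le> l" and \<theta>_pos: "0 < \<theta>" and \<theta>_less1: "\<theta> < 1"
    and R_large: "2 * real l \<le> \<theta> * real R" and \<Lambda>_ge1: "1 \<le> \<Lambda>"
begin

definition a :: real where "a = (1 - \<theta>) / real l"
text \<open>Arguments p, q, b, c are the numbers of elements in C, A - C, D and B - D, divided by m.\<close>

definition devA :: "real \<Rightarrow> real \<Rightarrow> real" where "devA p q = a * (p - (p + q) / real R)"
definition massA :: "real \<Rightarrow> real \<Rightarrow> real" where "massA p q = a * (p + q)"
definition freeB :: "real \<Rightarrow> real \<Rightarrow> real" where "freeB b c = 1 - (b + c) / real l"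

text \<open>
Since exp P (1 - P) = 1 - O(P^2), the difference F - G has no first-order term in P. The factor
1 - \<theta> in a leaves room for the elements of A - C, which decrease P.
\<close>

definition F :: "real \<Rightarrow> real \<Rightarrow> real \<Rightarrow> real \<Rightarrow> real" where
  "F p q b c = freeB b c - exp (devA p q - massA p q) * (freeB b c - devA p q * (1 - b))"

definition G :: "real \<Rightarrow> real \<Rightarrow> real" where
  "G y z = z * (1 - exp (- y))"

text \<open>The term exp (- 2 * \<Lambda>) keeps the argument of the logarithm in the cutoff positive.\<close>

definition dist2 :: "real \<Rightarrow> real \<Rightarrow> real \<Rightarrow> real \<Rightarrow> real" where
  "dist2 p q b c = ((devA p q)\<^sup>2 + (1 - b - freeB b c)\<^sup>2) / 2 + exp (- 2 * \<Lambda>)"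

text \<open>For \<open>0 < T \<le> exp (- \<Lambda>)\<close> this is 0, and it reaches 1 at
  \<open>T = 1\<close>; the transition has length \<Lambda> in \<open>ln T\<close>. Hence on (0, 1]
  the first derivative times T and the second times T^2 are of order 1 / \<Lambda>.\<close>

definition cutoff :: "real \<Rightarrow> real" where
  "cutoff T = (max 0 (1 + ln T / \<Lambda>)) ^ 3"

text \<open>The mixed second derivative in any two unit directions is
  \<open>- 800 / \<Lambda>\<close>, which pays for the error in \<open>cutoff_error_bound\<close>.
  \<open>R + l\<close> is the largest sum of densities in the box and keeps the term nonnegative
  there.\<close>

definition slack :: "real \<Rightarrow> real" where
  "slack \<sigma> = 400 / \<Lambda> * ((real R + real l)\<^sup>2 - \<sigma>\<^sup>2)"

definition blend :: "real \<Rightarrow> real \<Rightarrow> real \<Rightarrow> real \<Rightarrow> real" where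
  "blend p q b c = G (massA p q) (freeB b c)
     + cutoff (dist2 p q b c) * (F p q b c - G (massA p q) (freeB b c)) + slack (p + q + b + c)"

definition box :: "real \<Rightarrow> real \<Rightarrow> real \<Rightarrow> real \<Rightarrow> bool" where
  "box p q b c \<longleftrightarrow> 0 \<le> p \<and> p \<le> 1 \<and> 0 \<le> q \<and> q \<le> real R - 1 \<and>
     0 \<le> b \<and> b \<le> 1 \<and> 0 \<le> c \<and> c \<le> real l - 1"

definition unit_vec :: "real \<Rightarrow> real \<Rightarrow> real \<Rightarrow> real \<Rightarrow> bool" where
  "unit_vec p q b c \<longleftrightarrow> (p, q, b, c) \<in> {(1, 0, 0, 0), (0, 1, 0, 0), (0, 0, 1, 0), (0, 0, 0, 1)}"

section \<open>Signs and sizes of the ingredients on the box\<close>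

lemma l_pos: "0 < real l" and R_pos: "0 < real R" and l_le_R: "2 * l \<le> R"
proof -
  show "0 < real l" using l_ge2 by simp
  then have "0 < \<theta> * real R" using R_large by linarith
  then show R: "0 < real R" using \<theta>_pos by (simp add: zero_less_mult_iff)
  have "\<theta> * real R \<le> real R" using \<theta>_less1 R by (simp add: mult_left_le_one_le)
  then show "2 * l \<le> R" using R_large by linarith
qed

lemma a_pos: "0 < a" and a_le: "a \<le> 1 / real l" and a_le_half: "a \<le> 1 / 2"
proof -
  show "0 < a" using \<theta>_less1 l_pos by (simp add: a_def)
  show 1: "a \<le> 1 / real l" using \<theta>_pos l_pos by (simp add: a_def divide_right_mono)
  have "1 / real l \<le> 1 / 2" using l_ge2 by (simp add: field_simps)
  with 1 show "a \<le> 1 / 2" by linarith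
qed

lemma theta_delta: "2 / real R \<le> \<theta> / real l"
  using R_large l_pos R_pos by (simp add: field_simps)

lemma box_bounds:
  assumes "box p q b c"
  shows "devA p q \<le> a" "- a \<le> devA p q" "0 \<le> massA p q" "- devA p q \<le> massA p q / real R"
    "0 \<le> massA p q - devA p q"
    "0 \<le> freeB b c" "freeB b c \<le> 1" "1 - b \<le> real l * freeB b c"
proof -
  have x: "0 \<le> p" "p \<le> 1" "0 \<le> q" "q \<le> real R - 1" "0 \<le> b" "b \<le> 1" "0 \<le> c" "c \<le> real l - 1"
    using assms by (auto simp: box_def)
  have r: "0 \<le> (p + q) / real R" "(p + q) / real R \<le> 1"
    using x R_pos by (auto simp: field_simps)
  have "p - (p + q) / real R \<le> 1" "- 1 \<le> p - (p + q) / real R"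
    using x r by linarith+
  then have "a * (p - (p + q) / real R) \<le> a * 1" "a * (- 1) \<le> a * (p - (p + q) / real R)"
    using a_pos by (auto simp only: mult_le_cancel_left_pos)
  then show "devA p q \<le> a" "- a \<le> devA p q" by (auto simp: devA_def)
  show "0 \<le> massA p q" using x a_pos by (simp add: massA_def)
  have "a * ((p + q) / real R - p) \<le> a * ((p + q) / real R)"
    using a_pos x by (intro mult_left_mono) auto
  then show "- devA p q \<le> massA p q / real R"
    by (simp add: devA_def massA_def algebra_simps)
  have "a * (p - (p + q) / real R) \<le> a * (p + q)"
    using a_pos x r by (intro mult_left_mono) linarith+
  then show "0 \<le> massA p q - devA p q" by (simp add: devA_def massA_def)
  show "0 \<le> freeB b c" "freeB b c \<le> 1"
    using x l_pos by (auto simp: freeB_def field_simps)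
  have "real l * freeB b c = real l - b - c" using l_pos by (simp add: freeB_def field_simps)
  then show "1 - b \<le> real l * freeB b c" using x by linarith
qed

text \<open>The margin bought by the factor \<open>1 - \<theta>\<close>: with
  \<open>w = 1 - b\<close>, the bounds \<open>P \<le> a\<close> and \<open>w \<le> l * z\<close>
  leave \<open>w / l - a * w\<close>. Part of it is consumed by elements of \<open>A - C\<close> in
  \<open>F_mixed_nonneg\<close>.\<close>

lemma J_ge:
  assumes "box p q b c"
  shows "\<theta> / real l * (1 - b) \<le> freeB b c - devA p q * (1 - b)"
proof -
  have "0 \<le> 1 - b" using assms by (auto simp: box_def)
  then have "devA p q * (1 - b) \<le> a * (1 - b)"
    using box_bounds[OF assms] by (intro mult_right_mono) auto
  moreover have "(1 - b) / real l \<le> freeB b c"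
    using box_bounds[OF assms] l_pos by (simp add: field_simps)
  moreover have "a * (1 - b) = (1 - b) / real l - \<theta> / real l * (1 - b)"
    using l_pos by (simp add: a_def field_simps)
  ultimately show ?thesis by linarith
qed

text \<open>Multiplied by \<open>exp (y - P)\<close>, the claim compares
  \<open>z - P * (1 - b)\<close> with \<open>exp (y - P) * z\<close>. Only P < 0 is delicate:
  \<open>- P \<le> y / R\<close>, \<open>1 - b \<le> l * z\<close> and \<open>l \<le> R\<close>
  bound the surplus by \<open>y * z\<close>, and \<open>1 + x \<le> exp x\<close> absorbs
  it.\<close>

lemma F_nonneg:
  assumes "box p q b c" shows "0 \<le> F p q b c"
proof -
  note bb = box_bounds[OF assms]
  let ?P = "devA p q" and ?y = "massA p q" and ?Z = "freeB b c"
  have w: "0 \<le> 1 - b" using assms by (auto simp: box_def)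
  have "?Z - ?P * (1 - b) \<le> exp (?y - ?P) * ?Z"
  proof (cases "0 \<le> ?P")
    case True
    have "?Z \<le> exp (?y - ?P) * ?Z"
      using bb by (simp add: mult_le_cancel_right1)
    then show ?thesis using True w by (smt (verit) mult_nonneg_nonneg)
  next
    case False
    have "real l * (- ?P) \<le> real l * (?y / real R)"
      using bb l_pos by (intro mult_left_mono) auto
    also have "\<dots> \<le> ?y"
    proof -
      have "real l * ?y \<le> real R * ?y"
        using bb l_le_R by (intro mult_right_mono) auto
      then show ?thesis using R_pos by (simp add: field_simps)
    qed
    finally have 1: "real l * (- ?P) \<le> ?y - ?P" using False by linarith
    have "- ?P * (1 - b) \<le> - ?P * (real l * ?Z)"
      using False bb by (intro mult_left_mono) auto
    also have "\<dots> = real l * (- ?P) * ?Z" by simp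
    also have "\<dots> \<le> (?y - ?P) * ?Z" using 1 bb by (intro mult_right_mono) auto
    finally have "?Z - ?P * (1 - b) \<le> (1 + (?y - ?P)) * ?Z" by (simp add: algebra_simps)
    also have "\<dots> \<le> exp (?y - ?P) * ?Z"
      using bb by (intro mult_right_mono exp_ge_add_one_self) auto
    finally show ?thesis .
  qed
  then have "exp (?P - ?y) * (?Z - ?P * (1 - b)) \<le> exp (?P - ?y) * (exp (?y - ?P) * ?Z)"
    by (intro mult_left_mono) auto
  also have "\<dots> = ?Z" by (simp add: exp_add[symmetric] mult.assoc[symmetric])
  finally show ?thesis by (simp add: F_def)
qed

lemma F_le:
  assumes "box p q b c" shows "F p q b c \<le> freeB b c"
proof -
  have "0 \<le> \<theta> / real l * (1 - b)" using assms \<theta>_pos by (auto simp: box_def)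
  then have "0 \<le> freeB b c - devA p q * (1 - b)" using J_ge[OF assms] by linarith
  then show ?thesis by (simp add: F_def)
qed

lemma G_bounds:
  assumes "box p q b c"
  shows "0 \<le> G (massA p q) (freeB b c)" "G (massA p q) (freeB b c) \<le> freeB b c"
  using box_bounds[OF assms] by (auto simp: G_def mult_left_le)

text \<open>The upper bound keeps the cutoff in [0, 1], so that \<open>blend\<close> is a convex
  combination of \<open>F\<close> and \<open>G\<close> plus slack. It holds because 1/8 + 1/2 + 1/3
  < 1, the 1/8 coming from \<open>a \<le> 1 / 2\<close> and the 1/3 from
  \<open>1 \<le> \<Lambda>\<close>.\<close>

lemma dist2_bounds:
  assumes "box p q b c"
  shows "0 < dist2 p q b c" "dist2 p q b c \<le> 1"
proof -
  note bb = box_bounds[OF assms]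
  show "0 < dist2 p q b c" unfolding dist2_def by (intro add_nonneg_pos) auto
  have "\<bar>devA p q\<bar> \<le> 1 / 2" using bb a_le_half by linarith
  then have 1: "(devA p q)\<^sup>2 \<le> (1 / 2)\<^sup>2" by (simp add: abs_le_square_iff[symmetric])
  have "\<bar>1 - b - freeB b c\<bar> \<le> 1" using bb assms by (auto simp: box_def)
  then have 2: "(1 - b - freeB b c)\<^sup>2 \<le> 1" by (simp add: abs_square_le_1)
  have "exp (- 2 * \<Lambda>) \<le> exp (- 2)" using \<Lambda>_ge1 by simp
  also have "\<dots> \<le> (1 / 3 :: real)"
  proof -
    have "3 \<le> exp (2::real)" using exp_ge_add_one_self[of "2::real"] by simp
    then show ?thesis by (simp add: exp_minus field_simps)
  qed
  finally have 3: "exp (- 2 * \<Lambda>) \<le> 1 / 3" .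
  have "(1 / 2)\<^sup>2 = (1 / 4 :: real)" by (simp add: power2_eq_square)
  then show "dist2 p q b c \<le> 1" using 1 2 3 unfolding dist2_def by argo
qed

lemma cutoff_bounds:
  assumes "0 < T" "T \<le> 1" shows "0 \<le> cutoff T" "cutoff T \<le> 1"
proof -
  show "0 \<le> cutoff T" by (simp add: cutoff_def)
  have "ln T / \<Lambda> \<le> 0" using assms \<Lambda>_ge1 by (auto simp: divide_le_0_iff)
  then show "cutoff T \<le> 1" unfolding cutoff_def by (intro power_le_one) auto
qed

lemma slack_bounds:
  assumes "box p q b c"
  shows "0 \<le> slack (p + q + b + c)" "slack (p + q + b + c) \<le> 400 / \<Lambda> * (real R + real l)\<^sup>2"
proof -
  have "0 \<le> p + q + b + c" "p + q + b + c \<le> real R + real l"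
    using assms by (auto simp: box_def)
  then have "(p + q + b + c)\<^sup>2 \<le> (real R + real l)\<^sup>2" by (intro power_mono)
  then show "0 \<le> slack (p + q + b + c)" using \<Lambda>_ge1 by (simp add: slack_def)
  show "slack (p + q + b + c) \<le> 400 / \<Lambda> * (real R + real l)\<^sup>2"
    unfolding slack_def using \<Lambda>_ge1 by (intro mult_left_mono) auto
qed

lemma blend_convex:
  "blend p q b c = (1 - cutoff (dist2 p q b c)) * G (massA p q) (freeB b c)
     + cutoff (dist2 p q b c) * F p q b c + slack (p + q + b + c)"
  by (simp add: blend_def algebra_simps)

lemma blend_nonneg:
  assumes "box p q b c" shows "0 \<le> blend p q b c"
  unfolding blend_convex
  using cutoff_bounds[OF dist2_bounds[OF assms]] G_bounds[OF assms] F_nonneg[OF assms]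
    slack_bounds[OF assms] by (intro add_nonneg_nonneg mult_nonneg_nonneg) auto

lemma blend_ge:
  assumes "box p q b c" shows "cutoff (dist2 p q b c) * F p q b c \<le> blend p q b c"
  unfolding blend_convex
  using cutoff_bounds[OF dist2_bounds[OF assms]] G_bounds[OF assms]
    slack_bounds[OF assms] by simp

lemma blend_le:
  assumes "box p q b c" shows "blend p q b c \<le> 1 + 400 / \<Lambda> * (real R + real l)\<^sup>2"
proof -
  let ?k = "cutoff (dist2 p q b c)"
  have "(1 - ?k) * G (massA p q) (freeB b c) + ?k * F p q b c \<le> (1 - ?k) * freeB b c + ?k * freeB b c"
    using cutoff_bounds[OF dist2_bounds[OF assms]] G_bounds[OF assms] F_le[OF assms]
    by (intro add_mono mult_left_mono) auto
  also have "\<dots> \<le> 1" using box_bounds[OF assms] by (simp add: algebra_simps)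
  finally show ?thesis using slack_bounds[OF assms] unfolding blend_convex by linarith
qed

lemma blend_symmetric:
  assumes "((devA p q)\<^sup>2 + (1 - b - freeB b c)\<^sup>2) / 2 + exp (- 2 * \<Lambda>) \<le> exp (- \<Lambda>)"
  shows "blend p q b c = G (massA p q) (freeB b c) + slack (p + q + b + c)"
proof -
  have "0 < dist2 p q b c" unfolding dist2_def by (intro add_nonneg_pos) auto
  then have "ln (dist2 p q b c) \<le> - \<Lambda>"
    using assms unfolding dist2_def[symmetric] by (metis ln_exp ln_mono)
  then have "1 + ln (dist2 p q b c) / \<Lambda> \<le> 0" using \<Lambda>_ge1 by (simp add: field_simps)
  then have "cutoff (dist2 p q b c) = 0" by (simp add: cutoff_def)
  then show ?thesis by (simp add: blend_def)
qed

end

lemma abs_mult_le_mult: "\<bar>x\<bar> \<le> (u::real) \<Longrightarrow> \<bar>y\<bar> \<le> v \<Longrightarrow> \<bar>x * y\<bar> \<le> u * v"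
  unfolding abs_mult by (intro mult_mono) auto

section \<open>Signs of the mixed second derivatives of F and G\<close>

context symmetry_gap
begin

text \<open>The expression is the mixed derivative of \<open>F\<close> divided by
  \<open>- exp (P - y)\<close>; here \<open>q1\<close> and \<open>q2\<close> are the derivatives of
  \<open>y - P\<close>. Directions in A move only P and y, directions in B only Z and w, so two
  directions in B give 0. The tight cases contain a direction in \<open>A - C\<close>, along which P
  decreases.\<close>

lemma F_mixed_nonneg:
  assumes bx: "box p q b c" and d: "unit_vec d1 d2 d3 d4" and e: "unit_vec e1 e2 e3 e4"
  defines "P \<equiv> devA p q" and "Z \<equiv> freeB b c" and "w \<equiv> 1 - b"
    and "P1 \<equiv> devA d1 d2" and "P2 \<equiv> devA e1 e2"
    and "q1 \<equiv> massA d1 d2 - devA d1 d2" and "q2 \<equiv> massA e1 e2 - devA e1 e2"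
    and "Z1 \<equiv> - (d3 + d4) / real l" and "Z2 \<equiv> - (e3 + e4) / real l"
    and "w1 \<equiv> - d3" and "w2 \<equiv> - e3"
  shows "0 \<le> q1 * q2 * (Z - P * w) - q1 * (Z2 - P2 * w - P * w2) - q2 * (Z1 - P1 * w - P * w1)
     - (P1 * w2 + P2 * w1)"
proof -
  note bb = box_bounds[OF bx, folded P_def Z_def]
  define \<delta> where "\<delta> = 1 / real R"
  have \<delta>: "0 < \<delta>" "2 * \<delta> \<le> \<theta> / real l" "\<delta> \<le> 1"
    using R_pos theta_delta l_le_R l_ge2 by (auto simp: \<delta>_def)
  have w: "0 \<le> w" "w \<le> 1" using bx by (auto simp: w_def box_def)
  have J: "\<theta> / real l * w \<le> Z - P * w" using J_ge[OF bx] by (simp add: P_def Z_def w_def)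
  have \<theta>w: "2 * \<delta> * w \<le> \<theta> / real l * w" using \<delta> w by (intro mult_right_mono) auto
  have J0: "0 \<le> Z - P * w" "2 * \<delta> * w \<le> Z - P * w"
  proof -
    show "2 * \<delta> * w \<le> Z - P * w" using J \<theta>w by linarith
    moreover have "0 \<le> 2 * \<delta> * w" using \<delta> w by simp
    ultimately show "0 \<le> Z - P * w" by linarith
  qed
  have P: "2 * \<delta> \<le> 1 / real l - P"
  proof -
    have "a = 1 / real l - \<theta> / real l" by (simp add: a_def diff_divide_distrib)
    then show ?thesis using bb \<delta> by linarith
  qed
  have dev: "devA 1 0 = a * (1 - \<delta>)" "devA 0 1 = - (a * \<delta>)" "devA 0 0 = 0"
    "massA 1 0 = a" "massA 0 1 = a" "massA 0 0 = 0"
    by (auto simp: devA_def massA_def \<delta>_def)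
  \<comment> \<open>The letters name the classes of the two elements: \<open>c\<close> for C,
    \<open>a\<close> for A - C, \<open>b\<close> for D; \<open>b'\<close> serves the pairs with B -
    D. The critical facts are \<open>2 * \<delta> * w \<le> Z - P * w\<close> for \<open>aa\<close>
    and \<open>\<delta> \<le> 1 / real l - P\<close> for \<open>ab\<close>, both due to
    \<open>2 / real R \<le> \<theta> / real l\<close>.\<close>
  have cc: "0 \<le> (a * \<delta>) * (a * \<delta>) * (Z - P * w) + (a * \<delta>) * (a * (1 - \<delta>) * w) + (a * \<delta>) * (a * (1 - \<delta>) * w)"
    using J0 \<delta> a_pos w by (intro add_nonneg_nonneg mult_nonneg_nonneg) auto
  have ca: "0 \<le> (a * \<delta>) * (a * (1 + \<delta>)) * (Z - P * w) + (a * \<delta>) * (- (a * \<delta>) * w) + (a * (1 + \<delta>)) * (a * (1 - \<delta>) * w)"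
  proof -
    have "0 \<le> (1 + \<delta>) * (1 - \<delta>) - \<delta> * \<delta>"
    proof -
      have "\<theta> / real l \<le> 1 / 2"
        using \<theta>_less1 \<theta>_pos l_ge2 by (simp add: divide_le_eq)
      then have "\<delta> \<le> 1 / 4" using \<delta> by linarith
      then have "\<delta> * \<delta> \<le> (1 / 4) * (1 / 4)" using \<delta> by (intro mult_mono) auto
      then show ?thesis by (simp add: algebra_simps)
    qed
    then have "0 \<le> a * a * (((1 + \<delta>) * (1 - \<delta>) - \<delta> * \<delta>) * w)"
      using a_pos w by (intro mult_nonneg_nonneg) auto
    moreover have "0 \<le> (a * \<delta>) * (a * (1 + \<delta>)) * (Z - P * w)"
      using a_pos \<delta> J0 by (intro mult_nonneg_nonneg) auto
    ultimately show ?thesis by (simp add: algebra_simps)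
  qed
  have aa: "0 \<le> (a * (1 + \<delta>)) * (a * (1 + \<delta>)) * (Z - P * w) + (a * (1 + \<delta>)) * (- (a * \<delta>) * w) + (a * (1 + \<delta>)) * (- (a * \<delta>) * w)"
  proof -
    have "Z - P * w \<le> (1 + \<delta>) * (Z - P * w)" using J0 \<delta> by (simp add: algebra_simps)
    then have "0 \<le> a * (1 + \<delta>) * a * ((1 + \<delta>) * (Z - P * w) - 2 * \<delta> * w)"
      using a_pos \<delta> J0 by (intro mult_nonneg_nonneg) auto
    then show ?thesis by (simp add: algebra_simps)
  qed
  have cb: "0 \<le> (a * \<delta>) * (1 / real l - P) + a * (1 - \<delta>)"
    using a_pos \<delta> P by (intro add_nonneg_nonneg mult_nonneg_nonneg) auto
  have ab: "0 \<le> (a * (1 + \<delta>)) * (1 / real l - P) - a * \<delta>"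
  proof -
    have "a * \<delta> \<le> a * (1 / real l - P)" using a_pos \<delta> P by (intro mult_left_mono) auto
    also have "\<dots> \<le> a * (1 + \<delta>) * (1 / real l - P)"
      using a_pos \<delta> P by (intro mult_right_mono) (auto simp: algebra_simps)
    finally show ?thesis by simp
  qed
  have b': "0 \<le> (a * \<delta>) * (1 / real l)" "0 \<le> (a * (1 + \<delta>)) * (1 / real l)"
    using a_pos \<delta> by auto
  have q: "a - a * (1 - \<delta>) = a * \<delta>" "a + a * \<delta> = a * (1 + \<delta>)"
    by (auto simp: algebra_simps)
  let ?A = "\<lambda>P q Z w. Z = 0 \<and> w = 0 \<and> (P = a * (1 - \<delta>) \<and> q = a * \<delta> \<or> P = - (a * \<delta>) \<and> q = a * (1 + \<delta>))"
  let ?B = "\<lambda>P q Z w. P = 0 \<and> q = 0 \<and> Z = - (1 / real l) \<and> (w = 0 \<or> w = - 1)"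
  have d': "?A P1 q1 Z1 w1 \<or> ?B P1 q1 Z1 w1"
    using d unfolding unit_vec_def P1_def q1_def Z1_def w1_def by (auto simp: dev q)
  have e': "?A P2 q2 Z2 w2 \<or> ?B P2 q2 Z2 w2"
    using e unfolding unit_vec_def P2_def q2_def Z2_def w2_def by (auto simp: dev q)
  have AB: "0 \<le> - (q * (Z - P * w)) - P' * w" if "?A P' q Z0 w0" "?B P0 q0 Z w" for P' q Z0 w0 P0 q0 Z w
  proof -
    have "0 \<le> q * (1 / real l)" "0 \<le> q * (1 / real l - P) + P'"
      using that(1) b' cb ab by auto
    moreover have "- (q * (Z - P * w)) - P' * w = q * (1 / real l) \<or>
        - (q * (Z - P * w)) - P' * w = q * (1 / real l - P) + P'"
      using that(2) by (auto simp: algebra_simps)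
    ultimately show ?thesis by auto
  qed
  have AA: "0 \<le> q1 * q2 * (Z - P * w) + q1 * (P2 * w) + q2 * (P1 * w)" if A12: "?A P1 q1 Z1 w1" "?A P2 q2 Z2 w2"
  proof -
    consider "P1 = a * (1 - \<delta>)" "q1 = a * \<delta>" "P2 = a * (1 - \<delta>)" "q2 = a * \<delta>"
      | "P1 = a * (1 - \<delta>)" "q1 = a * \<delta>" "P2 = - (a * \<delta>)" "q2 = a * (1 + \<delta>)"
      | "P1 = - (a * \<delta>)" "q1 = a * (1 + \<delta>)" "P2 = a * (1 - \<delta>)" "q2 = a * \<delta>"
      | "P1 = - (a * \<delta>)" "q1 = a * (1 + \<delta>)" "P2 = - (a * \<delta>)" "q2 = a * (1 + \<delta>)"
      using A12 by blast
    then show ?thesis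
    proof cases
      case 1 show ?thesis unfolding 1 using cc by (simp only:)
    next
      case 2 show ?thesis unfolding 2 using ca by (simp only:)
    next
      case 3 show ?thesis unfolding 3 using ca by (simp add: add_ac mult_ac)
    next
      case 4 show ?thesis unfolding 4 using aa by (simp only:)
    qed
  qed
  from d' show ?thesis
  proof
    assume d: "?A P1 q1 Z1 w1"
    from e' show ?thesis
    proof
      assume e: "?A P2 q2 Z2 w2"
      have "Z1 = 0" "w1 = 0" "Z2 = 0" "w2 = 0" using d e by blast+
      then show ?thesis using AA[OF d e] by simp
    next
      assume e: "?B P2 q2 Z2 w2"
      have "Z1 = 0" "w1 = 0" "P2 = 0" "q2 = 0" using d e by blast+
      then show ?thesis using AB[OF d e] by simp
    qed
  next
    assume d: "?B P1 q1 Z1 w1"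
    from e' show ?thesis
    proof
      assume e: "?A P2 q2 Z2 w2"
      have "Z2 = 0" "w2 = 0" "P1 = 0" "q1 = 0" using d e by blast+
      then show ?thesis using AB[OF e d] by simp
    next
      assume e: "?B P2 q2 Z2 w2"
      have "P1 = 0" "q1 = 0" "P2 = 0" "q2 = 0" using d e by blast+
      then show ?thesis by simp
    qed
  qed
qed

lemma G_mixed_nonpos:
  assumes bx: "box p q b c" and d: "unit_vec d1 d2 d3 d4" and e: "unit_vec e1 e2 e3 e4"
  defines "Z \<equiv> freeB b c"
    and "y1 \<equiv> massA d1 d2" and "y2 \<equiv> massA e1 e2"
    and "Z1 \<equiv> - (d3 + d4) / real l" and "Z2 \<equiv> - (e3 + e4) / real l"
  shows "Z1 * y2 + Z2 * y1 - Z * y1 * y2 \<le> 0"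
proof -
  have "0 \<le> Z" using box_bounds[OF bx] by (simp add: Z_def)
  moreover have "0 \<le> y1" "0 \<le> y2" "Z1 \<le> 0" "Z2 \<le> 0"
    using d e a_pos l_pos by (auto simp: unit_vec_def y1_def y2_def Z1_def Z2_def massA_def)
  ultimately have "Z1 * y2 \<le> 0" "Z2 * y1 \<le> 0" "0 \<le> Z * y1 * y2"
    by (auto intro: mult_nonpos_nonneg)
  then show ?thesis by linarith
qed

lemma unit_vec_bounds:
  assumes "unit_vec d1 d2 d3 d4"
  shows "\<bar>devA d1 d2\<bar> \<le> 1" "\<bar>massA d1 d2\<bar> \<le> 1" "\<bar>massA d1 d2 - devA d1 d2\<bar> \<le> 1"
    "\<bar>- (d3 + d4) / real l\<bar> \<le> 1" "\<bar>- d3\<bar> \<le> 1" "\<bar>- d3 - (- (d3 + d4) / real l)\<bar> \<le> 1"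
    "d1 + d2 + d3 + d4 = 1"
proof -
  define \<delta> where "\<delta> = 1 / real R"
  have \<delta>: "0 < \<delta>" "\<delta> \<le> 1" using R_pos l_le_R l_ge2 by (auto simp: \<delta>_def)
  have dev: "devA 1 0 = a * (1 - \<delta>)" "devA 0 1 = - (a * \<delta>)" "devA 0 0 = 0"
    "massA 1 0 = a" "massA 0 1 = a" "massA 0 0 = 0"
    by (auto simp: devA_def massA_def \<delta>_def)
  have ad: "0 \<le> a * \<delta>" "a * \<delta> \<le> a" using a_pos \<delta> by (auto simp: mult_left_le)
  have r: "a * (1 - \<delta>) = a - a * \<delta>" by (simp add: algebra_simps)
  have ad': "a * \<delta> \<le> 1" "a + a * \<delta> \<le> 1" using ad a_le_half by linarith+
  have l1: "0 < 1 / real l" "1 / real l \<le> 1" using l_ge2 by auto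
  show "\<bar>devA d1 d2\<bar> \<le> 1" "\<bar>massA d1 d2\<bar> \<le> 1" "\<bar>massA d1 d2 - devA d1 d2\<bar> \<le> 1"
    "\<bar>- (d3 + d4) / real l\<bar> \<le> 1" "\<bar>- d3\<bar> \<le> 1" "\<bar>- d3 - (- (d3 + d4) / real l)\<bar> \<le> 1"
    "d1 + d2 + d3 + d4 = 1"
    using assms a_pos a_le_half ad ad' l1 unfolding unit_vec_def by (auto simp: dev r)
qed

text \<open>Everything follows from \<open>1 + x \<le> exp x\<close> at \<open>P\<close> and
  \<open>- P\<close>. The last two bounds quantify the cancellation that removes the first-order
  term of F - G in P.\<close>

lemma exp_dev_bounds:
  assumes "\<bar>P\<bar> \<le> (1/2::real)"
  shows "exp P \<le> 2" "\<bar>1 - exp P\<bar> \<le> 2 * \<bar>P\<bar>" "0 \<le> 1 - exp P * (1 - P)" "1 - exp P * (1 - P) \<le> P\<^sup>2"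
proof -
  have 1: "1 - P \<le> exp (- P)" using exp_ge_add_one_self[of "- P"] by simp
  have 2: "1 + P \<le> exp P" using exp_ge_add_one_self[of P] by simp
  have P: "1 / 2 \<le> 1 - P" using assms by linarith
  have "exp P * (1 - P) \<le> exp P * exp (- P)" using 1 by (intro mult_left_mono) auto
  also have "\<dots> = 1" by (simp add: exp_minus)
  finally have 3: "exp P * (1 - P) \<le> 1" .
  then show "0 \<le> 1 - exp P * (1 - P)" by simp
  have "exp P * (1 / 2) \<le> exp P * (1 - P)" using P by (intro mult_left_mono) auto
  then show e2: "exp P \<le> 2" using 3 by linarith
  have "(1 + P) * (1 - P) \<le> exp P * (1 - P)" using 2 P by (intro mult_right_mono) auto
  then show "1 - exp P * (1 - P) \<le> P\<^sup>2" by (simp add: algebra_simps power2_eq_square)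
  have "exp P - 1 \<le> exp P * P" using 3 by (simp add: algebra_simps)
  also have "\<dots> \<le> 2 * \<bar>P\<bar>" using e2 by (intro order_trans[OF mult_left_mono[OF abs_ge_self] mult_right_mono]) auto
  finally show "\<bar>1 - exp P\<bar> \<le> 2 * \<bar>P\<bar>" using 2 by linarith
qed

end

lemma abs_divide_le: "0 < T \<Longrightarrow> \<bar>x\<bar> \<le> c * T \<Longrightarrow> \<bar>x / T\<bar> \<le> (c::real)"
  by (simp add: abs_divide pos_divide_le_eq)

text \<open>
Here T plays the role of the squared distance and M of the truncated logarithm; the point is that
the derivatives of the cutoff are of order 1 / (\<Lambda> r) and 1 / (\<Lambda> r^2), matched by H = O(r^2).
\<close>

lemma cutoff_error_bound:
  fixes T r \<Lambda> M :: real
  assumes T: "0 < T" and \<Lambda>: "1 \<le> \<Lambda>" and r: "0 \<le> r" "r\<^sup>2 \<le> 4 * T" and M: "0 \<le> M" "M \<le> 1"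
    and T1: "\<bar>T1\<bar> \<le> r" "\<bar>T2\<bar> \<le> r" "\<bar>T12\<bar> \<le> 2"
    and H: "\<bar>H\<bar> \<le> 6 * T" "\<bar>H1\<bar> \<le> 15 * r" "\<bar>H2\<bar> \<le> 15 * r"
  defines "u1 \<equiv> T1 / T / \<Lambda>" and "u2 \<equiv> T2 / T / \<Lambda>" and "u12 \<equiv> (T12 / T - T1 * T2 / T\<^sup>2) / \<Lambda>"
  shows "(6 * M * u1 * u2 + 3 * M\<^sup>2 * u12) * H + 3 * M\<^sup>2 * u1 * H2 + 3 * M\<^sup>2 * u2 * H1 \<le> 800 / \<Lambda>"
proof -
  have M2: "0 \<le> M\<^sup>2" "M\<^sup>2 \<le> 1" using M by (auto simp: power_le_one)
  have tt: "\<bar>T1 * T2\<bar> \<le> 4 * T"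
    using abs_mult_le_mult[OF T1(1) T1(2)] r by (simp add: power2_eq_square)
  have th: "\<bar>T1 * H2\<bar> \<le> 60 * T" "\<bar>T2 * H1\<bar> \<le> 60 * T"
    using abs_mult_le_mult[OF T1(1) H(3)] abs_mult_le_mult[OF T1(2) H(2)] r
    by (simp_all add: power2_eq_square)
  have l1: "1 / \<Lambda> \<le> 1" "0 < 1 / \<Lambda>" using \<Lambda> by auto
  have a1: "\<bar>u1 * u2 * H\<bar> \<le> 24 / \<Lambda>"
  proof -
    have "u1 * u2 * H = (T1 * T2 / T) * (H / T) * (1 / \<Lambda>) * (1 / \<Lambda>)"
      by (simp add: u1_def u2_def mult_ac)
    moreover have "\<bar>T1 * T2 / T\<bar> \<le> 4" "\<bar>H / T\<bar> \<le> 6" using abs_divide_le[OF T tt] abs_divide_le[OF T H(1)] .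
    then have "\<bar>(T1 * T2 / T) * (H / T)\<bar> \<le> 4 * 6" by (rule abs_mult_le_mult)
    then have "\<bar>(T1 * T2 / T) * (H / T) * (1 / \<Lambda>)\<bar> \<le> 24 * 1"
      by (intro abs_mult_le_mult) (use l1 in simp_all)
    then have "\<bar>(T1 * T2 / T) * (H / T) * (1 / \<Lambda>) * (1 / \<Lambda>)\<bar> \<le> 24 * (1 / \<Lambda>)"
      by (intro abs_mult_le_mult) (use l1 in simp_all)
    ultimately show ?thesis by simp
  qed
  have a2: "\<bar>u12 * H\<bar> \<le> 36 / \<Lambda>"
  proof -
    have "u12 * H = (T12 - T1 * T2 / T) * (H / T) * (1 / \<Lambda>)"
      by (simp add: u12_def left_diff_distrib right_diff_distrib diff_divide_distrib power2_eq_square mult_ac)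
    moreover have "\<bar>T1 * T2 / T\<bar> \<le> 4" "\<bar>H / T\<bar> \<le> 6" using abs_divide_le[OF T tt] abs_divide_le[OF T H(1)] .
    then have "\<bar>(T12 - T1 * T2 / T) * (H / T)\<bar> \<le> 6 * 6"
      by (intro abs_mult_le_mult) (use T1 in linarith)+
    then have "\<bar>(T12 - T1 * T2 / T) * (H / T) * (1 / \<Lambda>)\<bar> \<le> 36 * (1 / \<Lambda>)"
      by (intro abs_mult_le_mult) (use l1 in simp_all)
    ultimately show ?thesis by simp
  qed
  have a3: "\<bar>u1 * H2\<bar> \<le> 60 / \<Lambda>" "\<bar>u2 * H1\<bar> \<le> 60 / \<Lambda>"
  proof -
    have "\<bar>(T1 * H2 / T) * (1 / \<Lambda>)\<bar> \<le> 60 * (1 / \<Lambda>)"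
      by (intro abs_mult_le_mult abs_divide_le[OF T th(1)]) (use l1 in simp)
    then show "\<bar>u1 * H2\<bar> \<le> 60 / \<Lambda>" by (simp add: u1_def)
    have "\<bar>(T2 * H1 / T) * (1 / \<Lambda>)\<bar> \<le> 60 * (1 / \<Lambda>)"
      by (intro abs_mult_le_mult abs_divide_le[OF T th(2)]) (use l1 in simp)
    then show "\<bar>u2 * H1\<bar> \<le> 60 / \<Lambda>" by (simp add: u2_def)
  qed
  have "\<bar>M * (u1 * u2 * H)\<bar> \<le> 1 * (24 / \<Lambda>)" "\<bar>M\<^sup>2 * (u12 * H)\<bar> \<le> 1 * (36 / \<Lambda>)"
    "\<bar>M\<^sup>2 * (u1 * H2)\<bar> \<le> 1 * (60 / \<Lambda>)" "\<bar>M\<^sup>2 * (u2 * H1)\<bar> \<le> 1 * (60 / \<Lambda>)"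
    using M M2 by (intro abs_mult_le_mult a1 a2 a3; simp)+
  moreover have "(6 * M * u1 * u2 + 3 * M\<^sup>2 * u12) * H + 3 * M\<^sup>2 * u1 * H2 + 3 * M\<^sup>2 * u2 * H1
    = 6 * (M * (u1 * u2 * H)) + 3 * (M\<^sup>2 * (u12 * H)) + 3 * (M\<^sup>2 * (u1 * H2)) + 3 * (M\<^sup>2 * (u2 * H1))"
    by (simp add: algebra_simps)
  \<comment> \<open>The sum is 144 + 108 + 180 + 180 = 612; the rounded value 800 is what the slack
    supplies.\<close>
  moreover have "6 * (24 / \<Lambda>) + 3 * (36 / \<Lambda>) + 3 * (60 / \<Lambda>) + 3 * (60 / \<Lambda>) \<le> 800 / \<Lambda>"
    using \<Lambda> by (simp add: divide_right_mono)
  ultimately show ?thesis by linarith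
qed

section \<open>Size of F - G and of its first derivatives near balance\<close>

context symmetry_gap
begin

text \<open>Substituting \<open>1 - b = V + z\<close> turns F - G into exp (- y) times the sum of z
  (1 - exp P (1 - P)), at most P^2, and exp P P V, at most 2 |P V|. Both are controlled by P^2 +
  V^2, which is below twice \<open>dist2\<close>.\<close>

lemma gap_bound:
  assumes bx: "box p q b c"
  defines "P \<equiv> devA p q" and "V \<equiv> 1 - b - freeB b c"
  shows "\<bar>F p q b c - G (massA p q) (freeB b c)\<bar> \<le> 6 * dist2 p q b c"
proof -
  note bb = box_bounds[OF bx, folded P_def]
  let ?Z = "freeB b c" and ?y = "massA p q"
  have P: "\<bar>P\<bar> \<le> 1 / 2" using bb a_le_half by linarith
  note ex = exp_dev_bounds[OF P]
  have eq: "F p q b c - G ?y ?Z = exp (- ?y) * (?Z * (1 - exp P * (1 - P)) + exp P * P * V)"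
    by (simp add: F_def G_def V_def P_def[symmetric] exp_diff exp_minus field_simps)
  have e1: "\<bar>exp (- ?y)\<bar> \<le> 1" using bb by simp
  have "\<bar>?Z * (1 - exp P * (1 - P))\<bar> \<le> 1 * P\<^sup>2"
    using bb ex by (intro abs_mult_le_mult) auto
  moreover have "\<bar>exp P * P * V\<bar> \<le> P\<^sup>2 + V\<^sup>2"
  proof -
    have "\<bar>exp P * (P * V)\<bar> \<le> 2 * \<bar>P * V\<bar>" using ex by (intro abs_mult_le_mult) auto
    also have "\<dots> = 2 * \<bar>P\<bar> * \<bar>V\<bar>" by (simp add: abs_mult)
    also have "\<dots> \<le> P\<^sup>2 + V\<^sup>2" using sum_squares_bound[of "\<bar>P\<bar>" "\<bar>V\<bar>"] by simp
    finally show ?thesis by (simp add: mult.assoc)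
  qed
  ultimately have "\<bar>?Z * (1 - exp P * (1 - P)) + exp P * P * V\<bar> \<le> 2 * (P\<^sup>2 + V\<^sup>2)"
    by (smt (verit) zero_le_power2)
  then have "\<bar>exp (- ?y) * (?Z * (1 - exp P * (1 - P)) + exp P * P * V)\<bar> \<le> 1 * (2 * (P\<^sup>2 + V\<^sup>2))"
    using e1 by (intro abs_mult_le_mult)
  moreover have "2 * (P\<^sup>2 + V\<^sup>2) \<le> 6 * dist2 p q b c"
    using exp_gt_zero[of "- 2 * \<Lambda>"] zero_le_power2[of P] zero_le_power2[of V]
    unfolding dist2_def P_def[symmetric] V_def[symmetric] by argo
  ultimately show ?thesis using eq by simp
qed

text \<open>The left side is the derivative of F - G in the direction \<open>d\<close>. After
  regrouping, every term has a factor \<open>1 - exp P\<close>, \<open>P\<close> or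
  \<open>V\<close>, so it is of first order in the deviations; 15 is a generous constant.\<close>

lemma gap_deriv_bound:
  assumes bx: "box p q b c" and d: "unit_vec d1 d2 d3 d4"
  defines "P \<equiv> devA p q" and "V \<equiv> 1 - b - freeB b c" and "y \<equiv> massA p q" and "Z \<equiv> freeB b c"
    and "P1 \<equiv> devA d1 d2" and "y1 \<equiv> massA d1 d2" and "Z1 \<equiv> - (d3 + d4) / real l"
  shows "\<bar>(Z1 - exp (P - y) * (Z1 - P1 * (1 - b) - P * (- d3) - (y1 - P1) * (Z - P * (1 - b))))
     - (Z1 * (1 - exp (- y)) + Z * (y1 * exp (- y)))\<bar> \<le> 15 * (\<bar>P\<bar> + \<bar>V\<bar>)"
proof -
  note bb = box_bounds[OF bx, folded P_def y_def Z_def]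
  note uv = unit_vec_bounds[OF d, folded P1_def y1_def Z1_def]
  have P: "\<bar>P\<bar> \<le> 1 / 2" using bb a_le_half by linarith
  note ex = exp_dev_bounds[OF P]
  have w: "\<bar>1 - b\<bar> \<le> 1" using bx by (auto simp: box_def)
  have eq: "(Z1 - exp (P - y) * (Z1 - P1 * (1 - b) - P * (- d3) - (y1 - P1) * (Z - P * (1 - b))))
     - (Z1 * (1 - exp (- y)) + Z * (y1 * exp (- y)))
     = exp (- y) * ((Z1 - Z * y1) * (1 - exp P) + exp P * (P1 * V - (y1 - P1) * (P * (1 - b)) + P * (- d3)))"
    by (simp add: V_def Z_def[symmetric] exp_diff exp_minus field_simps)
  have "\<bar>Z * y1\<bar> \<le> 1 * 1" using bb uv by (intro abs_mult_le_mult) auto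
  then have "\<bar>(Z1 - Z * y1) * (1 - exp P)\<bar> \<le> 2 * (2 * \<bar>P\<bar>)"
    using uv ex by (intro abs_mult_le_mult) linarith+
  moreover have "\<bar>exp P * (P1 * V - (y1 - P1) * (P * (1 - b)) + P * (- d3))\<bar> \<le> 2 * (\<bar>V\<bar> + 2 * \<bar>P\<bar>)"
  proof (intro abs_mult_le_mult)
    show "\<bar>exp P\<bar> \<le> 2" using ex by simp
    have "\<bar>P1 * V\<bar> \<le> 1 * \<bar>V\<bar>" using uv by (intro abs_mult_le_mult) auto
    moreover have "\<bar>P * (1 - b)\<bar> \<le> \<bar>P\<bar> * 1" using w by (intro abs_mult_le_mult) auto
    then have "\<bar>(y1 - P1) * (P * (1 - b))\<bar> \<le> 1 * \<bar>P\<bar>" using uv by (intro abs_mult_le_mult) auto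
    moreover have "\<bar>P * (- d3)\<bar> \<le> \<bar>P\<bar> * 1" using uv by (intro abs_mult_le_mult) auto
    ultimately show "\<bar>P1 * V - (y1 - P1) * (P * (1 - b)) + P * (- d3)\<bar> \<le> \<bar>V\<bar> + 2 * \<bar>P\<bar>" by linarith
  qed
  ultimately have "\<bar>(Z1 - Z * y1) * (1 - exp P) + exp P * (P1 * V - (y1 - P1) * (P * (1 - b)) + P * (- d3))\<bar>
      \<le> 2 * (2 * \<bar>P\<bar>) + 2 * (\<bar>V\<bar> + 2 * \<bar>P\<bar>)"
    by (intro order_trans[OF abs_triangle_ineq] add_mono)
  also have "\<dots> \<le> 15 * (\<bar>P\<bar> + \<bar>V\<bar>)" by simp
  finally have "\<bar>(Z1 - Z * y1) * (1 - exp P) + exp P * (P1 * V - (y1 - P1) * (P * (1 - b)) + P * (- d3))\<bar>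
      \<le> 15 * (\<bar>P\<bar> + \<bar>V\<bar>)" .
  moreover have "\<bar>exp (- y)\<bar> \<le> 1" using bb by simp
  ultimately have "\<bar>exp (- y) * ((Z1 - Z * y1) * (1 - exp P) + exp P * (P1 * V - (y1 - P1) * (P * (1 - b)) + P * (- d3)))\<bar>
      \<le> 1 * (15 * (\<bar>P\<bar> + \<bar>V\<bar>))"
    by (intro abs_mult_le_mult)
  then show ?thesis unfolding eq by simp
qed

end

section \<open>Nonpositive mixed second differences of the blend\<close>

context symmetry_gap
begin

lemma box_between:
  assumes bx: "box p q b c" "box (p + h * d1 + h * e1) (q + h * d2 + h * e2) (b + h * d3 + h * e3) (c + h * d4 + h * e4)"
    and d: "unit_vec d1 d2 d3 d4" "unit_vec e1 e2 e3 e4"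
    and st: "0 \<le> s" "s \<le> h" "0 \<le> t" "t \<le> h"
  shows "box (p + s * d1 + t * e1) (q + s * d2 + t * e2) (b + s * d3 + t * e3) (c + s * d4 + t * e4)"
proof -
  have nn: "0 \<le> d1" "0 \<le> d2" "0 \<le> d3" "0 \<le> d4" "0 \<le> e1" "0 \<le> e2" "0 \<le> e3" "0 \<le> e4"
    using d by (auto simp: unit_vec_def)
  have mono: "x \<le> x + s * d + t * e" "x + s * d + t * e \<le> x + h * d + h * e"
    if "0 \<le> d" "0 \<le> e" for x d e :: real
    using that st by (auto intro!: add_mono mult_right_mono)
  show ?thesis
    using bx mono(1)[OF nn(1) nn(5), of p] mono(2)[OF nn(1) nn(5), of p]
      mono(1)[OF nn(2) nn(6), of q] mono(2)[OF nn(2) nn(6), of q]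
      mono(1)[OF nn(3) nn(7), of b] mono(2)[OF nn(3) nn(7), of b]
      mono(1)[OF nn(4) nn(8), of c] mono(2)[OF nn(4) nn(8), of c]
    unfolding box_def by linarith
qed

lemma blend_second_difference:
  assumes bx: "box p q b c" "box (p + h * d1 + h * e1) (q + h * d2 + h * e2) (b + h * d3 + h * e3) (c + h * d4 + h * e4)"
    and d: "unit_vec d1 d2 d3 d4" and e: "unit_vec e1 e2 e3 e4" and h: "0 \<le> h"
  shows "blend (p + h * d1 + h * e1) (q + h * d2 + h * e2) (b + h * d3 + h * e3) (c + h * d4 + h * e4) + blend p q b c
    \<le> blend (p + h * d1) (q + h * d2) (b + h * d3) (c + h * d4) + blend (p + h * e1) (q + h * e2) (b + h * e3) (c + h * e4)"
proof -
  define pp where "pp s t = p + s * d1 + t * e1" for s t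
  define qq where "qq s t = q + s * d2 + t * e2" for s t
  define bb where "bb s t = b + s * d3 + t * e3" for s t
  define cc where "cc s t = c + s * d4 + t * e4" for s t
  note coord = pp_def qq_def bb_def cc_def
  define P y Z w where "P s t = devA (pp s t) (qq s t)" and "y s t = massA (pp s t) (qq s t)"
    and "Z s t = freeB (bb s t) (cc s t)" and "w s t = 1 - bb s t" for s t
  define V where "V s t = w s t - Z s t" for s t
  define P1 P2 y1 y2 where "P1 = devA d1 d2" and "P2 = devA e1 e2" and "y1 = massA d1 d2" and "y2 = massA e1 e2"
  define Z1 Z2 w1 w2 where "Z1 = - (d3 + d4) / real l" and "Z2 = - (e3 + e4) / real l" and "w1 = - d3" and "w2 = - e3"
  define V1 V2 where "V1 = w1 - Z1" and "V2 = w2 - Z2"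
  define J where "J s t = Z s t - P s t * w s t" for s t
  define E where "E s t = exp (P s t - y s t)" for s t
  define e' where "e' s t = exp (- y s t)" for s t
  define T where "T s t = dist2 (pp s t) (qq s t) (bb s t) (cc s t)" for s t
  define u where "u s t = 1 + ln (T s t) / \<Lambda>" for s t
  define M where "M s t = max 0 (u s t)" for s t

  have jP: "mixed_jet P (\<lambda>_ _. P1) (\<lambda>_ _. P2) (\<lambda>_ _. 0)"
    by (rule mixed_jet_cong[OF mixed_jet_affine[of "devA p q" P1 P2]])
      (simp_all add: P_def P1_def P2_def devA_def coord algebra_simps add_divide_distrib)
  have jy: "mixed_jet y (\<lambda>_ _. y1) (\<lambda>_ _. y2) (\<lambda>_ _. 0)"
    by (rule mixed_jet_cong[OF mixed_jet_affine[of "massA p q" y1 y2]])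
      (simp_all add: y_def y1_def y2_def massA_def coord algebra_simps)
  have jny: "mixed_jet (\<lambda>s t. - y s t) (\<lambda>_ _. - y1) (\<lambda>_ _. - y2) (\<lambda>_ _. 0)"
    by (rule mixed_jet_cong[OF mixed_jet_affine[of "- massA p q" "- y1" "- y2"]])
      (simp_all add: y_def y1_def y2_def massA_def coord algebra_simps)
  have jZ: "mixed_jet Z (\<lambda>_ _. Z1) (\<lambda>_ _. Z2) (\<lambda>_ _. 0)"
    by (rule mixed_jet_cong[OF mixed_jet_affine[of "freeB b c" Z1 Z2]])
      (simp_all add: Z_def Z1_def Z2_def freeB_def coord algebra_simps add_divide_distrib diff_divide_distrib)
  have jw: "mixed_jet w (\<lambda>_ _. w1) (\<lambda>_ _. w2) (\<lambda>_ _. 0)"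
    by (rule mixed_jet_cong[OF mixed_jet_affine[of "1 - b" w1 w2]])
      (simp_all add: w_def w1_def w2_def coord algebra_simps)
  have jV: "mixed_jet V (\<lambda>_ _. V1) (\<lambda>_ _. V2) (\<lambda>_ _. 0)"
    by (rule mixed_jet_cong[OF mixed_jet_diff[OF jw jZ]]) (simp_all add: V_def V1_def V2_def)
  have jE: "mixed_jet E (\<lambda>s t. - (y1 - P1) * E s t) (\<lambda>s t. - (y2 - P2) * E s t)
      (\<lambda>s t. (y1 - P1) * (y2 - P2) * E s t)"
    by (rule mixed_jet_cong[OF mixed_jet_compose[OF mixed_jet_diff[OF jP jy], of exp exp exp]])
      (auto intro!: derivative_eq_intros simp: E_def algebra_simps)
  have jJ: "mixed_jet J (\<lambda>s t. Z1 - P1 * w s t - P s t * w1) (\<lambda>s t. Z2 - P2 * w s t - P s t * w2)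
      (\<lambda>s t. - (P1 * w2 + P2 * w1))"
    by (rule mixed_jet_cong[OF mixed_jet_diff[OF jZ mixed_jet_mult[OF jP jw]]])
      (simp_all add: J_def algebra_simps)
  define F1 where "F1 s t = Z1 - E s t * (Z1 - P1 * w s t - P s t * w1 - (y1 - P1) * J s t)" for s t
  define F2 where "F2 s t = Z2 - E s t * (Z2 - P2 * w s t - P s t * w2 - (y2 - P2) * J s t)" for s t
  define F12 where "F12 s t = - E s t * ((y1 - P1) * (y2 - P2) * J s t - (y1 - P1) * (Z2 - P2 * w s t - P s t * w2)
      - (y2 - P2) * (Z1 - P1 * w s t - P s t * w1) - (P1 * w2 + P2 * w1))" for s t
  have jF: "mixed_jet (\<lambda>s t. F (pp s t) (qq s t) (bb s t) (cc s t)) F1 F2 F12"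
    by (rule mixed_jet_cong[OF mixed_jet_diff[OF jZ mixed_jet_mult[OF jE jJ]]])
      (simp_all add: F_def F1_def F2_def F12_def E_def J_def P_def y_def Z_def w_def algebra_simps)
  have je': "mixed_jet e' (\<lambda>s t. - y1 * e' s t) (\<lambda>s t. - y2 * e' s t) (\<lambda>s t. y1 * y2 * e' s t)"
    by (rule mixed_jet_cong[OF mixed_jet_compose[OF jny, of exp exp exp]])
      (auto intro!: derivative_eq_intros simp: e'_def algebra_simps)
  define G1 where "G1 s t = Z1 * (1 - e' s t) + Z s t * (y1 * e' s t)" for s t
  define G2 where "G2 s t = Z2 * (1 - e' s t) + Z s t * (y2 * e' s t)" for s t
  define G12 where "G12 s t = e' s t * (Z1 * y2 + Z2 * y1 - Z s t * y1 * y2)" for s t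
  have jG: "mixed_jet (\<lambda>s t. G (y s t) (Z s t)) G1 G2 G12"
    by (rule mixed_jet_cong[OF mixed_jet_diff[OF jZ mixed_jet_mult[OF jZ je']]])
      (simp_all add: G_def G1_def G2_def G12_def e'_def algebra_simps)
  define T1 T2 where "T1 s t = P s t * P1 + V s t * V1" and "T2 s t = P s t * P2 + V s t * V2" for s t
  define T12 where "T12 = P1 * P2 + V1 * V2"
  have T_eq: "T s t = 1 / 2 * (P s t * P s t + V s t * V s t) + exp (- 2 * \<Lambda>)" for s t
    by (simp add: T_def dist2_def P_def V_def w_def Z_def power2_eq_square)
  have jT: "mixed_jet T T1 T2 (\<lambda>_ _. T12)"
    by (rule mixed_jet_cong[OF mixed_jet_add[OF mixed_jet_mult[OF mixed_jet_affine[of "1/2" 0 0]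
          mixed_jet_add[OF mixed_jet_mult[OF jP jP] mixed_jet_mult[OF jV jV]]] mixed_jet_affine[of "exp (- 2 * \<Lambda>)" 0 0]]])
      (simp_all add: T_eq T1_def T2_def T12_def algebra_simps)
  \<comment> \<open>Needed for all real parameters, also outside the box, because a jet requires
    derivatives everywhere; the summand \<open>exp (- 2 * \<Lambda>)\<close> guarantees it.\<close>
  have Tpos: "0 < T s t" for s t
    unfolding T_def dist2_def by (intro add_nonneg_pos) auto
  define u1 u2 where "u1 s t = T1 s t / T s t / \<Lambda>" and "u2 s t = T2 s t / T s t / \<Lambda>" for s t
  define u12 where "u12 s t = (T12 / T s t - T1 s t * T2 s t / (T s t)\<^sup>2) / \<Lambda>" for s t
  have ju: "mixed_jet u u1 u2 u12"
  proof (rule mixed_jet_cong[OF mixed_jet_compose[OF jT,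
        of "\<lambda>x. 1 + ln x / \<Lambda>" "\<lambda>x. inverse x / \<Lambda>" "\<lambda>x. - inverse (x\<^sup>2) / \<Lambda>"]])
    fix s t
    show "((\<lambda>x. 1 + ln x / \<Lambda>) has_real_derivative inverse (T s t) / \<Lambda>) (at (T s t))"
      using Tpos[of s t] \<Lambda>_ge1 by (auto intro!: derivative_eq_intros simp: inverse_eq_divide)
    show "((\<lambda>x. inverse x / \<Lambda>) has_real_derivative - inverse ((T s t)\<^sup>2) / \<Lambda>) (at (T s t))"
      using Tpos[of s t] \<Lambda>_ge1 by (auto intro!: derivative_eq_intros simp: power2_eq_square)
  qed (simp_all add: u_def u1_def u2_def u12_def divide_inverse power2_eq_square algebra_simps)
  define K1 K2 where "K1 s t = 3 * (M s t)\<^sup>2 * u1 s t" and "K2 s t = 3 * (M s t)\<^sup>2 * u2 s t" for s t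
  define K12 where "K12 s t = 6 * M s t * u1 s t * u2 s t + 3 * (M s t)\<^sup>2 * u12 s t" for s t
  have jK: "mixed_jet (\<lambda>s t. cutoff (T s t)) K1 K2 K12"
  proof (rule mixed_jet_cong[OF mixed_jet_compose[OF ju,
        of "\<lambda>x. (max 0 x) ^ 3" "\<lambda>x. 3 * (max 0 x)\<^sup>2" "\<lambda>x. 6 * max 0 x"]])
    fix s t
    show "((\<lambda>x. (max 0 x) ^ 3) has_real_derivative 3 * (max 0 (u s t))\<^sup>2) (at (u s t))"
      using DERIV_pos_part_power[of 3 "u s t"] by simp
    show "((\<lambda>x. 3 * (max 0 x)\<^sup>2) has_real_derivative 6 * max 0 (u s t)) (at (u s t))"
      using DERIV_cmult[OF DERIV_pos_part_power[of 2 "u s t"], of 3] by simp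
  qed (simp_all add: cutoff_def K1_def K2_def K12_def M_def u_def)
  define \<sigma> where "\<sigma> s t = pp s t + qq s t + bb s t + cc s t" for s t
  have j\<sigma>: "mixed_jet \<sigma> (\<lambda>_ _. 1) (\<lambda>_ _. 1) (\<lambda>_ _. 0)"
  proof (rule mixed_jet_cong[OF mixed_jet_affine[of "p + q + b + c" 1 1]])
    fix s t
    have "\<sigma> s t = p + q + b + c + s * (d1 + d2 + d3 + d4) + t * (e1 + e2 + e3 + e4)"
      by (simp add: \<sigma>_def coord algebra_simps)
    then show "p + q + b + c + s * 1 + t * 1 = \<sigma> s t"
      by (simp add: unit_vec_bounds[OF d] unit_vec_bounds[OF e])
  qed simp_all
  have jS: "mixed_jet (\<lambda>s t. slack (\<sigma> s t)) (\<lambda>s t. 400 / \<Lambda> * (- 2 * \<sigma> s t)) (\<lambda>s t. 400 / \<Lambda> * (- 2 * \<sigma> s t))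
     (\<lambda>_ _. - 800 / \<Lambda>)"
    unfolding slack_def
    by (rule mixed_jet_cong[OF mixed_jet_compose[OF j\<sigma>, of "\<lambda>x. 400 / \<Lambda> * ((real R + real l)\<^sup>2 - x\<^sup>2)"
         "\<lambda>x. 400 / \<Lambda> * (- 2 * x)" "\<lambda>x. - 800 / \<Lambda>"]])
      (use \<Lambda>_ge1 in \<open>auto intro!: derivative_eq_intros\<close>)
  define H where "H s t = F (pp s t) (qq s t) (bb s t) (cc s t) - G (y s t) (Z s t)" for s t
  have jH: "mixed_jet H (\<lambda>s t. F1 s t - G1 s t) (\<lambda>s t. F2 s t - G2 s t) (\<lambda>s t. F12 s t - G12 s t)"
    using mixed_jet_diff[OF jF jG] unfolding H_def .
  \<comment> \<open>The three summands containing a derivative of the cutoff form the error that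
    \<open>- 800 / \<Lambda>\<close> outweighs. What remains is a convex combination of
    \<open>G12\<close> and \<open>F12\<close>, both nonpositive on the box.\<close>
  define B12 where "B12 s t = G12 s t + (K12 s t * H s t + K1 s t * (F2 s t - G2 s t) + K2 s t * (F1 s t - G1 s t)
     + cutoff (T s t) * (F12 s t - G12 s t)) + - 800 / \<Lambda>" for s t
  have jB: "mixed_jet (\<lambda>s t. G (y s t) (Z s t) + cutoff (T s t) * H s t + slack (\<sigma> s t))
     (\<lambda>s t. G1 s t + (K1 s t * H s t + cutoff (T s t) * (F1 s t - G1 s t)) + 400 / \<Lambda> * (- 2 * \<sigma> s t))
     (\<lambda>s t. G2 s t + (K2 s t * H s t + cutoff (T s t) * (F2 s t - G2 s t)) + 400 / \<Lambda> * (- 2 * \<sigma> s t)) B12"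
    unfolding B12_def by (rule mixed_jet_add[OF mixed_jet_add[OF jG mixed_jet_mult[OF jK jH]] jS])

  have neg: "B12 s t \<le> 0" if st: "0 \<le> s" "s \<le> h" "0 \<le> t" "t \<le> h" for s t
  proof -
    have bxst: "box (pp s t) (qq s t) (bb s t) (cc s t)"
      unfolding coord by (rule box_between[OF bx d e st])
    have FJ: "F12 s t \<le> 0"
      using F_mixed_nonneg[OF bxst d e] unfolding F12_def J_def P_def Z_def w_def P1_def P2_def y1_def y2_def
        Z1_def Z2_def w1_def w2_def E_def
      by (simp add: mult_nonneg_nonneg)
    have GJ: "G12 s t \<le> 0"
      using G_mixed_nonpos[OF bxst d e] unfolding G12_def Z_def y1_def y2_def Z1_def Z2_def e'_def
      by (intro mult_nonneg_nonpos) auto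
    define k where "k = cutoff (T s t)"
    have T: "0 < T s t" "T s t \<le> 1" using dist2_bounds[OF bxst] by (auto simp: T_def)
    have k: "0 \<le> k" "k \<le> 1" using cutoff_bounds[OF T] by (auto simp: k_def)
    have main: "G12 s t + k * (F12 s t - G12 s t) \<le> 0"
    proof -
      have "(1 - k) * G12 s t \<le> 0" "k * F12 s t \<le> 0"
        using k FJ GJ by (auto intro: mult_nonneg_nonpos)
      then show ?thesis by (simp add: algebra_simps)
    qed
    define r where "r = \<bar>P s t\<bar> + \<bar>V s t\<bar>"
    have Vdef: "V s t = 1 - bb s t - freeB (bb s t) (cc s t)" by (simp add: V_def w_def Z_def)
    have r2: "r\<^sup>2 \<le> 4 * T s t"
    proof -
      have "r\<^sup>2 \<le> 2 * ((P s t)\<^sup>2 + (V s t)\<^sup>2)"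
        using sum_squares_bound[of "\<bar>P s t\<bar>" "\<bar>V s t\<bar>"]
        unfolding r_def by (simp add: power2_sum)
      also have "\<dots> \<le> 4 * T s t"
        unfolding T_def dist2_def P_def Vdef using exp_gt_zero[of "- 2 * \<Lambda>"] by argo
      finally show ?thesis .
    qed
    note ud = unit_vec_bounds[OF d, folded P1_def y1_def Z1_def w1_def, folded V1_def]
    note ue = unit_vec_bounds[OF e, folded P2_def y2_def Z2_def w2_def, folded V2_def]
    have T1b: "\<bar>T1 s t\<bar> \<le> r"
      using abs_mult_le_mult[OF order_refl ud(1), of "P s t"] abs_mult_le_mult[OF order_refl ud(6), of "V s t"]
      unfolding T1_def r_def by linarith
    have T2b: "\<bar>T2 s t\<bar> \<le> r"
      using abs_mult_le_mult[OF order_refl ue(1), of "P s t"] abs_mult_le_mult[OF order_refl ue(6), of "V s t"]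
      unfolding T2_def r_def by linarith
    have T12b: "\<bar>T12\<bar> \<le> 2"
      using abs_mult_le_mult[OF ud(1) ue(1)] abs_mult_le_mult[OF ud(6) ue(6)]
      unfolding T12_def by linarith
    have Hb: "\<bar>H s t\<bar> \<le> 6 * T s t"
      using gap_bound[OF bxst] unfolding H_def T_def y_def Z_def .
    have H1b: "\<bar>F1 s t - G1 s t\<bar> \<le> 15 * r"
      using gap_deriv_bound[OF bxst d]
      unfolding F1_def G1_def r_def E_def J_def e'_def P_def y_def w_def Z_def P1_def y1_def Z1_def w1_def Vdef .
    have H2b: "\<bar>F2 s t - G2 s t\<bar> \<le> 15 * r"
      using gap_deriv_bound[OF bxst e]
      unfolding F2_def G2_def r_def E_def J_def e'_def P_def y_def w_def Z_def P2_def y2_def Z2_def w2_def Vdef .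
    have Mb: "0 \<le> M s t" "M s t \<le> 1"
    proof -
      have "ln (T s t) / \<Lambda> \<le> 0" using T \<Lambda>_ge1 by (auto simp: divide_le_0_iff)
      then show "0 \<le> M s t" "M s t \<le> 1" by (auto simp: M_def u_def)
    qed
    have "r \<ge> 0" by (simp add: r_def)
    have "K12 s t * H s t + K1 s t * (F2 s t - G2 s t) + K2 s t * (F1 s t - G1 s t) \<le> 800 / \<Lambda>"
      using cutoff_error_bound[OF T(1) \<Lambda>_ge1 \<open>r \<ge> 0\<close> r2 Mb T1b T2b T12b Hb H1b H2b]
      unfolding K12_def K1_def K2_def u1_def u2_def u12_def by simp
    then show ?thesis using main unfolding B12_def k_def by simp
  qed
  have "blend (pp s t) (qq s t) (bb s t) (cc s t) = G (y s t) (Z s t) + cutoff (T s t) * H s t + slack (\<sigma> s t)" for s t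
    by (simp add: blend_def y_def Z_def T_def H_def \<sigma>_def)
  note eq = this[symmetric]
  show ?thesis
    using second_difference_nonpos[OF jB h neg] unfolding eq coord by simp
qed

end

section \<open>Partition matroids with two blocks\<close>

definition two_block_indep :: "'a set \<Rightarrow> nat \<Rightarrow> 'a set \<Rightarrow> nat \<Rightarrow> 'a set set" where
  "two_block_indep A r B s = {S. S \<subseteq> A \<union> B \<and> card (S \<inter> A) \<le> r \<and> card (S \<inter> B) \<le> s}"

lemma card_split_two_blocks:
  assumes "finite A" "finite B" "A \<inter> B = {}" "S \<subseteq> A \<union> B"
  shows "card S = card (S \<inter> A) + card (S \<inter> B)"
proof -
  have "S = (S \<inter> A) \<union> (S \<inter> B)" using assms by auto
  moreover have "card ((S \<inter> A) \<union> (S \<inter> B)) = card (S \<inter> A) + card (S \<inter> B)"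
    using assms by (intro card_Un_disjoint) auto
  ultimately show ?thesis by simp
qed

lemma matroid_two_block:
  assumes fin: "finite A" "finite B" and disj: "A \<inter> B = {}"
  shows "matroid (A \<union> B) (two_block_indep A r B s)"
  unfolding matroid_def
proof (intro conjI ballI allI impI)
  show "finite (A \<union> B)" using fin by simp
  show "two_block_indep A r B s \<subseteq> Pow (A \<union> B)" by (auto simp: two_block_indep_def)
  show "{} \<in> two_block_indep A r B s" by (auto simp: two_block_indep_def)
next
  fix X Y assume X: "X \<in> two_block_indep A r B s" "Y \<subseteq> X"
  then have "card (Y \<inter> A) \<le> card (X \<inter> A)" "card (Y \<inter> B) \<le> card (X \<inter> B)"
    using fin by (auto intro!: card_mono)
  then show "Y \<in> two_block_indep A r B s" using X by (auto simp: two_block_indep_def)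
next
  have grow: "insert y X \<inter> K = insert y (X \<inter> K)" "card (insert y (X \<inter> K)) = Suc (card (X \<inter> K))"
    if "y \<in> K" "y \<notin> X" "finite K" for X K and y :: 'a
    using that by auto
  fix X Y assume X: "X \<in> two_block_indep A r B s" and Y: "Y \<in> two_block_indep A r B s"
    and less: "card X < card Y"
  have "card X = card (X \<inter> A) + card (X \<inter> B)" "card Y = card (Y \<inter> A) + card (Y \<inter> B)"
    using X Y by (auto intro!: card_split_two_blocks fin disj simp: two_block_indep_def)
  then consider "card (X \<inter> A) < card (Y \<inter> A)" | "card (X \<inter> B) < card (Y \<inter> B)"
    using less by linarith
  then show "\<exists>y\<in>Y - X. insert y X \<in> two_block_indep A r B s"
  proof cases
    case 1
    then have "\<not> Y \<inter> A \<subseteq> X \<inter> A" using fin by (metis card_mono finite_Int leD)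
    then obtain y where y: "y \<in> Y" "y \<in> A" "y \<notin> X" by auto
    then have "insert y X \<inter> B = X \<inter> B" using disj by auto
    then have "insert y X \<in> two_block_indep A r B s"
      using X Y y grow[OF y(2,3) fin(1)] 1 by (auto simp: two_block_indep_def)
    then show ?thesis using y by blast
  next
    case 2
    then have "\<not> Y \<inter> B \<subseteq> X \<inter> B" using fin by (metis card_mono finite_Int leD)
    then obtain y where y: "y \<in> Y" "y \<in> B" "y \<notin> X" by auto
    then have "insert y X \<inter> A = X \<inter> A" using disj by auto
    then have "insert y X \<in> two_block_indep A r B s"
      using X Y y grow[OF y(2,3) fin(2)] 2 by (auto simp: two_block_indep_def)
    then show ?thesis using y by blast
  qed
qed

lemma bases_two_block:
  assumes fin: "finite A" "finite B" and disj: "A \<inter> B = {}" and rs: "r \<le> card A" "s \<le> card B"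
  shows "bases (two_block_indep A r B s) = {S. S \<subseteq> A \<union> B \<and> card (S \<inter> A) = r \<and> card (S \<inter> B) = s}"
proof (intro equalityI subsetI)
  fix S assume S: "S \<in> bases (two_block_indep A r B s)"
  then have ind: "S \<subseteq> A \<union> B" "card (S \<inter> A) \<le> r" "card (S \<inter> B) \<le> s"
    and max: "\<And>X. X \<in> two_block_indep A r B s \<Longrightarrow> S \<subseteq> X \<Longrightarrow> X = S"
    by (auto simp: bases_def two_block_indep_def)
  have "\<not> card (S \<inter> A) < r"
  proof
    assume less: "card (S \<inter> A) < r"
    then have "\<not> A \<subseteq> S \<inter> A" using rs fin card_mono[of "S \<inter> A" A] by force
    then obtain y where y: "y \<in> A" "y \<notin> S" by auto
    have "insert y S \<inter> B = S \<inter> B" "insert y S \<inter> A = insert y (S \<inter> A)" using y disj by auto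
    then have "insert y S \<in> two_block_indep A r B s"
      using ind y less fin by (auto simp: two_block_indep_def card_insert_if)
    then show False using max[of "insert y S"] y by blast
  qed
  moreover have "\<not> card (S \<inter> B) < s"
  proof
    assume less: "card (S \<inter> B) < s"
    then have "\<not> B \<subseteq> S \<inter> B" using rs fin card_mono[of "S \<inter> B" B] by force
    then obtain y where y: "y \<in> B" "y \<notin> S" by auto
    have "insert y S \<inter> A = S \<inter> A" "insert y S \<inter> B = insert y (S \<inter> B)" using y disj by auto
    then have "insert y S \<in> two_block_indep A r B s"
      using ind y less fin by (auto simp: two_block_indep_def card_insert_if)
    then show False using max[of "insert y S"] y by blast
  qed
  ultimately show "S \<in> {S. S \<subseteq> A \<union> B \<and> card (S \<inter> A) = r \<and> card (S \<inter> B) = s}" using ind by auto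
next
  fix S assume S: "S \<in> {S. S \<subseteq> A \<union> B \<and> card (S \<inter> A) = r \<and> card (S \<inter> B) = s}"
  have "X = S" if X: "X \<in> two_block_indep A r B s" "S \<subseteq> X" for X
  proof -
    have "card X = card (X \<inter> A) + card (X \<inter> B)" "card S = card (S \<inter> A) + card (S \<inter> B)"
      using X S by (auto intro!: card_split_two_blocks fin disj simp: two_block_indep_def)
    then have "card X \<le> card S" using X S by (auto simp: two_block_indep_def)
    moreover have "finite X" using X fin by (auto simp: two_block_indep_def intro: finite_subset)
    ultimately show "X = S" using card_seteq[OF \<open>finite X\<close> X(2)] by simp
  qed
  then show "S \<in> bases (two_block_indep A r B s)"
    using S by (auto simp: bases_def two_block_indep_def)
qed

text \<open>The \<open>l\<close> bases \<open>U j \<union> (B - W j)\<close>, each of weight 1 / (l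
  - 1), use an element of A at most once and an element of B exactly l - 1 times. For optimality the
  packing constraints are summed over B only: every base takes (l - 1) m of its l m
  elements.\<close>

lemma packing_number_two_block:
  fixes U W :: "nat \<Rightarrow> 'a set" and l m :: nat
  assumes fin: "finite A" "finite B" and disj: "A \<inter> B = {}" and l: "2 \<le> l" and m: "1 \<le> m"
    and U: "\<And>j. j < l \<Longrightarrow> U j \<subseteq> A" "\<And>j. j < l \<Longrightarrow> card (U j) = m"
      "disjoint_family_on U {..<l}"
    and W: "\<And>j. j < l \<Longrightarrow> card (W j) = m" "disjoint_family_on W {..<l}" "(\<Union>j<l. W j) = B"
  shows "fractional_base_packing_number (A \<union> B) (bases (two_block_indep A m B ((l - 1) * m)))
     (real l / (real l - 1))"
proof -
  have WB: "W j \<subseteq> B" if "j < l" for j using W(3) that by blast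
  have finW: "finite (W j)" if "j < l" for j using WB[OF that] fin finite_subset by blast
  have cardB: "card B = l * m"
  proof -
    have "card (\<Union>j\<in>{..<l}. W j) = (\<Sum>j<l. card (W j))"
      using W(2) finW by (intro card_UN_disjoint) (auto simp: disjoint_family_on_def)
    then show ?thesis using W(1,3) by simp
  qed
  have "m \<le> card A" using U(1)[of 0] U(2)[of 0] l fin card_mono[of A "U 0"] by simp
  then have bases: "bases (two_block_indep A m B ((l - 1) * m)) =
      {S. S \<subseteq> A \<union> B \<and> card (S \<inter> A) = m \<and> card (S \<inter> B) = (l - 1) * m}"
    using cardB by (intro bases_two_block fin disj) auto
  let ?\<B> = "bases (two_block_indep A m B ((l - 1) * m))"
  have finB: "finite ?\<B>"
    unfolding bases by (rule finite_subset[of _ "Pow (A \<union> B)"]) (use fin in auto)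
  define X where "X j = U j \<union> (B - W j)" for j
  have XA: "X j \<inter> A = U j" "X j \<inter> B = B - W j" if "j < l" for j
    using U(1)[OF that] disj by (auto simp: X_def)
  have Xb: "X j \<in> ?\<B>" if "j < l" for j
  proof -
    have "card (B - W j) = (l - 1) * m"
      using card_Diff_subset[OF finW[OF that] WB[OF that]] W(1)[OF that] cardB
      by (simp add: diff_mult_distrib)
    then show ?thesis unfolding bases using XA[OF that] U(1,2)[OF that] by (auto simp: X_def)
  qed
  \<comment> \<open>Weights are attached to sets rather than indices, so coinciding bases would lose
    weight in the sum. Disjointness of the nonempty \<open>U j\<close> excludes this.\<close>
  have inj: "inj_on X {..<l}"
  proof (rule inj_onI)
    fix i j assume ij: "i \<in> {..<l}" "j \<in> {..<l}" "X i = X j"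
    then have eq: "U i = U j" using XA by (metis lessThan_iff)
    show "i = j"
    proof (rule ccontr)
      assume "i \<noteq> j"
      then have "U i \<inter> U j = {}" using U(3) ij by (auto simp: disjoint_family_on_def)
      then have "U i = {}" using eq by simp
      then show False using U(2)[of i] ij m by simp
    qed
  qed
  define w :: "'a set \<Rightarrow> real" where "w S = (if S \<in> X ` {..<l} then 1 / (real l - 1) else 0)" for S
  have l1: "0 < real l - 1" "1 \<le> real l - 1" using l by auto
  have sum_w: "(\<Sum>S\<in>?\<B>. w S * g S) = (\<Sum>j<l. g (X j)) / (real l - 1)" for g
  proof -
    have "(\<Sum>S\<in>?\<B>. w S * g S) = (\<Sum>S\<in>X ` {..<l}. w S * g S)"
      using Xb finB by (intro sum.mono_neutral_right) (auto simp: w_def)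
    also have "\<dots> = (\<Sum>j<l. w (X j) * g (X j))" by (rule sum.reindex_cong[OF inj refl refl])
    also have "\<dots> = (\<Sum>j<l. g (X j) / (real l - 1))" by (intro sum.cong) (auto simp: w_def)
    finally show ?thesis by (simp add: sum_divide_distrib)
  qed
  have pack: "fractional_packing (A \<union> B) ?\<B> w"
    unfolding fractional_packing_def
  proof (intro conjI ballI)
    show "0 \<le> w S" for S using l1 by (simp add: w_def)
    fix e assume "e \<in> A \<union> B"
    then consider "e \<in> A" "e \<notin> B" | "e \<in> B" "e \<notin> A" using disj by blast
    then have "(\<Sum>j<l. indicator (X j) e) \<le> real l - 1"
    proof cases
      case 1
      then have "(\<Sum>j<l. indicator (X j) e) = (\<Sum>j<l. indicator (U j) e :: real)"
        by (intro sum.cong) (auto simp: X_def indicator_def)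
      also have "\<dots> \<le> 1"
      proof (cases "\<exists>j<l. e \<in> U j")
        case True
        then obtain j where j: "j < l" "e \<in> U j" by blast
        then have "indicator (U i) e = (if i = j then 1 else 0 :: real)" if "i < l" for i
          using U(3) that by (auto simp: disjoint_family_on_def indicator_def)
        then have "(\<Sum>i<l. indicator (U i) e) = (\<Sum>i<l. if i = j then 1 else 0 :: real)"
          by (intro sum.cong) auto
        also have "\<dots> = 1" using j by simp
        finally show ?thesis by simp
      next
        case False
        then have "(\<Sum>i<l. indicator (U i) e) = (0 :: real)" by (intro sum.neutral) auto
        then show ?thesis by simp
      qed
      finally show ?thesis using l1 by linarith
    next
      case 2
      then obtain j where j: "j < l" "e \<in> W j" using W(3) by blast
      then have "indicator (X i) e = (1 - (if i = j then 1 else 0) :: real)" if "i < l" for i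
        using W(2) that 2 U(1)[OF that] by (auto simp: disjoint_family_on_def indicator_def X_def)
      then have "(\<Sum>i<l. indicator (X i) e) = (\<Sum>i<l. 1 - (if i = j then 1 else 0) :: real)"
        by (intro sum.cong) auto
      also have "\<dots> = real l - 1" using j by (simp add: sum_subtractf)
      finally show ?thesis by simp
    qed
    then show "(\<Sum>S\<in>?\<B>. w S * indicator S e) \<le> 1"
      unfolding sum_w using l1 by simp
  qed
  have "(\<Sum>S\<in>?\<B>. w S) = real l / (real l - 1)"
    using sum_w[of "\<lambda>_. 1"] by simp
  moreover have "(\<Sum>S\<in>?\<B>. v S) \<le> real l / (real l - 1)" if "fractional_packing (A \<union> B) ?\<B> v" for v
  proof -
    have "real ((l - 1) * m) * (\<Sum>S\<in>?\<B>. v S) = (\<Sum>S\<in>?\<B>. v S * real (card (S \<inter> B)))"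
      unfolding sum_distrib_left
    proof (rule sum.cong[OF refl])
      fix S assume "S \<in> ?\<B>"
      then have "card (S \<inter> B) = (l - 1) * m" unfolding bases by blast
      then show "real ((l - 1) * m) * v S = v S * real (card (S \<inter> B))" by simp
    qed
    also have "\<dots> = (\<Sum>S\<in>?\<B>. \<Sum>e\<in>B. v S * indicator S e)"
    proof (rule sum.cong[OF refl])
      fix S
      have "real (card (S \<inter> B)) = (\<Sum>e\<in>B. indicator S e)"
        using sum.inter_restrict[OF fin(2), of "\<lambda>_. 1 :: real" S]
        by (simp add: indicator_def Int_commute of_bool_def)
      then show "v S * real (card (S \<inter> B)) = (\<Sum>e\<in>B. v S * indicator S e)"
        by (simp add: sum_distrib_left)
    qed
    also have "\<dots> = (\<Sum>e\<in>B. \<Sum>S\<in>?\<B>. v S * indicator S e)" by (rule sum.swap)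
    also have "\<dots> \<le> (\<Sum>e\<in>B. 1)"
      using that by (intro sum_mono) (auto simp: fractional_packing_def)
    also have "\<dots> = real l * real m" by (simp add: cardB)
    finally have "real m * ((real l - 1) * (\<Sum>S\<in>?\<B>. v S)) \<le> real m * real l"
      using l by (simp add: of_nat_diff mult_ac)
    then have "(real l - 1) * (\<Sum>S\<in>?\<B>. v S) \<le> real l" using m by simp
    then show ?thesis using l1 by (simp add: field_simps)
  qed
  ultimately show ?thesis
    unfolding fractional_base_packing_number_def using pack by blast
qed

section \<open>Random transversals of a block partition\<close>

lemma exp_quadratic_bound:
  assumes "\<bar>x\<bar> \<le> (1::real)" shows "exp x \<le> 1 + x + x\<^sup>2"
proof (cases "0 \<le> x")
  case True
  then show ?thesis using exp_bound assms by simp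
next
  case False
  define t where "t = - x"
  have t: "0 \<le> t" using False by (simp add: t_def)
  \<comment> \<open>For a negative argument \<open>- t\<close> the factorisation of
    \<open>1 + t ^ 3\<close> combines with \<open>1 + t \<le> exp t\<close>.\<close>
  have "1 \<le> 1 + t ^ 3" using t by simp
  also have "\<dots> = (1 + t) * (1 - t + t\<^sup>2)" by (simp add: algebra_simps power2_eq_square power3_eq_cube)
  also have "\<dots> \<le> exp t * (1 - t + t\<^sup>2)"
  proof (rule mult_right_mono[OF exp_ge_add_one_self])
    have "0 \<le> (1 - t / 2)\<^sup>2 + 3 / 4 * t\<^sup>2" by simp
    then show "0 \<le> 1 - t + t\<^sup>2" by (simp add: power2_eq_square algebra_simps)
  qed
  finally have "exp (- t) * 1 \<le> exp (- t) * (exp t * (1 - t + t\<^sup>2))" by (intro mult_left_mono) auto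
  also have "\<dots> = 1 - t + t\<^sup>2" by (simp add: exp_minus)
  finally show ?thesis by (simp add: t_def)
qed

text \<open>The exponential moment method with counting instead of probability: the exponential of
  the sum factors over blocks, and within a block the linear term of \<open>1 + x + x^2\<close>
  cancels because the block sums vanish.\<close>

lemma chernoff_blocks:
  fixes z :: "nat \<Rightarrow> nat \<Rightarrow> real"
  assumes zero: "\<And>i. i < m \<Longrightarrow> (\<Sum>j<k. z i j) = 0"
    and bound: "\<And>i j. i < m \<Longrightarrow> j < k \<Longrightarrow> \<bar>z i j\<bar> \<le> 1"
    and \<eta>: "0 \<le> \<eta>" "\<eta> \<le> 1"
  shows "real (card {c \<in> {..<m} \<rightarrow>\<^sub>E {..<k}. \<eta> * real m < (\<Sum>i<m. z i (c i))})
     \<le> exp (- (\<eta>\<^sup>2 * real m / 4)) * real k ^ m"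
proof -
  \<comment> \<open>The minimiser of the exponent
    \<open>real m * \<rho>\<^sup>2 - \<rho> * (\<eta> * real m)\<close>.\<close>
  define \<rho> where "\<rho> = \<eta> / 2"
  have \<rho>: "0 \<le> \<rho>" "\<rho> \<le> 1" using \<eta> by (auto simp: \<rho>_def)
  let ?\<Omega> = "{..<m} \<rightarrow>\<^sub>E {..<k}"
  have fin: "finite ?\<Omega>" by (intro finite_PiE) auto
  let ?bad = "{c \<in> ?\<Omega>. \<eta> * real m < (\<Sum>i<m. z i (c i))}"
  have "real (card ?bad) * exp (\<rho> * (\<eta> * real m)) = (\<Sum>c\<in>?bad. exp (\<rho> * (\<eta> * real m)))"
    by simp
  also have "\<dots> \<le> (\<Sum>c\<in>?bad. exp (\<rho> * (\<Sum>i<m. z i (c i))))"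
  proof (rule sum_mono)
    fix c assume "c \<in> ?bad"
    then have "\<eta> * real m \<le> (\<Sum>i<m. z i (c i))" by simp
    then show "exp (\<rho> * (\<eta> * real m)) \<le> exp (\<rho> * (\<Sum>i<m. z i (c i)))"
      unfolding exp_le_cancel_iff using \<rho>(1) by (rule mult_left_mono)
  qed
  also have "\<dots> \<le> (\<Sum>c\<in>?\<Omega>. exp (\<rho> * (\<Sum>i<m. z i (c i))))"
    using fin by (intro sum_mono2) auto
  also have "\<dots> = (\<Sum>c\<in>?\<Omega>. \<Prod>i<m. exp (\<rho> * z i (c i)))"
    by (simp add: sum_distrib_left exp_sum)
  also have "\<dots> = (\<Prod>i<m. \<Sum>j<k. exp (\<rho> * z i j))"
    by (subst prod_sum_PiE) auto
  also have "\<dots> \<le> (\<Prod>i<m. real k * exp (\<rho>\<^sup>2))"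
  proof (intro prod_mono conjI)
    fix i assume i: "i \<in> {..<m}"
    show "0 \<le> (\<Sum>j<k. exp (\<rho> * z i j))" by (intro sum_nonneg) auto
    have "(\<Sum>j<k. exp (\<rho> * z i j)) \<le> (\<Sum>j<k. 1 + \<rho> * z i j + \<rho>\<^sup>2)"
    proof (rule sum_mono)
      fix j assume "j \<in> {..<k}"
      then have zz: "\<bar>z i j\<bar> \<le> 1" using bound i by auto
      have lz: "\<bar>\<rho> * z i j\<bar> \<le> \<rho> * 1"
        unfolding abs_mult using \<rho> zz by (intro mult_mono) auto
      then have "\<bar>\<rho> * z i j\<bar> \<le> 1" using \<rho> by linarith
      then have "exp (\<rho> * z i j) \<le> 1 + \<rho> * z i j + (\<rho> * z i j)\<^sup>2" by (rule exp_quadratic_bound)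
      moreover have "(\<rho> * z i j)\<^sup>2 \<le> \<rho>\<^sup>2" using lz \<rho> by (simp add: abs_le_square_iff[symmetric])
      ultimately show "exp (\<rho> * z i j) \<le> 1 + \<rho> * z i j + \<rho>\<^sup>2" by linarith
    qed
    also have "\<dots> = real k * (1 + \<rho>\<^sup>2)"
      using zero[of i] i by (simp add: sum.distrib sum_distrib_left[symmetric] algebra_simps)
    also have "\<dots> \<le> real k * exp (\<rho>\<^sup>2)"
      using exp_ge_add_one_self[of "\<rho>\<^sup>2"] by (intro mult_left_mono) auto
    finally show "(\<Sum>j<k. exp (\<rho> * z i j)) \<le> real k * exp (\<rho>\<^sup>2)" .
  qed
  also have "\<dots> = real k ^ m * exp (real m * \<rho>\<^sup>2)"
    by (simp add: power_mult_distrib exp_of_nat_mult)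
  finally have "real (card ?bad) * exp (\<rho> * (\<eta> * real m)) * exp (- (\<rho> * (\<eta> * real m)))
      \<le> real k ^ m * exp (real m * \<rho>\<^sup>2) * exp (- (\<rho> * (\<eta> * real m)))"
    by (intro mult_right_mono) auto
  then have "real (card ?bad) \<le> real k ^ m * exp (real m * \<rho>\<^sup>2 - \<rho> * (\<eta> * real m))"
    by (simp add: mult.assoc exp_add[symmetric] exp_diff exp_minus divide_inverse)
  also have "real m * \<rho>\<^sup>2 - \<rho> * (\<eta> * real m) = - (\<eta>\<^sup>2 * real m / 4)"
    by (simp add: \<rho>_def power2_eq_square field_simps)
  finally show ?thesis by (simp add: mult.commute)
qed

lemma chernoff_blocks_abs:
  fixes z :: "nat \<Rightarrow> nat \<Rightarrow> real"
  assumes "\<And>i. i < m \<Longrightarrow> (\<Sum>j<k. z i j) = 0" "\<And>i j. i < m \<Longrightarrow> j < k \<Longrightarrow> \<bar>z i j\<bar> \<le> 1"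
    and "0 \<le> \<eta>" "\<eta> \<le> 1"
  shows "real (card {c \<in> {..<m} \<rightarrow>\<^sub>E {..<k}. \<eta> * real m < \<bar>\<Sum>i<m. z i (c i)\<bar>})
     \<le> 2 * exp (- (\<eta>\<^sup>2 * real m / 4)) * real k ^ m"
proof -
  let ?\<Omega> = "{..<m} \<rightarrow>\<^sub>E {..<k}"
  let ?p = "{c \<in> ?\<Omega>. \<eta> * real m < (\<Sum>i<m. z i (c i))}"
  let ?n = "{c \<in> ?\<Omega>. \<eta> * real m < (\<Sum>i<m. - z i (c i))}"
  have "{c \<in> ?\<Omega>. \<eta> * real m < \<bar>\<Sum>i<m. z i (c i)\<bar>} \<subseteq> ?p \<union> ?n"
  proof
    fix c assume "c \<in> {c \<in> ?\<Omega>. \<eta> * real m < \<bar>\<Sum>i<m. z i (c i)\<bar>}"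
    then have "c \<in> ?\<Omega>" "\<eta> * real m < (\<Sum>i<m. z i (c i)) \<or> \<eta> * real m < - (\<Sum>i<m. z i (c i))"
      by (simp, simp, linarith)
    then show "c \<in> ?p \<union> ?n" unfolding sum_negf by blast
  qed
  moreover have "finite ?\<Omega>" by (intro finite_PiE) auto
  then have "finite (?p \<union> ?n)" by simp
  ultimately have "card {c \<in> ?\<Omega>. \<eta> * real m < \<bar>\<Sum>i<m. z i (c i)\<bar>} \<le> card (?p \<union> ?n)"
    by (rule card_mono[rotated])
  also have "\<dots> \<le> card ?p + card ?n" by (rule card_Un_le)
  finally have "real (card {c \<in> ?\<Omega>. \<eta> * real m < \<bar>\<Sum>i<m. z i (c i)\<bar>}) \<le> real (card ?p) + real (card ?n)"
    by linarith
  moreover have "real (card ?p) \<le> exp (- (\<eta>\<^sup>2 * real m / 4)) * real k ^ m"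
    using assms by (intro chernoff_blocks)
  moreover have "real (card ?n) \<le> exp (- (\<eta>\<^sup>2 * real m / 4)) * real k ^ m"
    using assms by (intro chernoff_blocks[where z = "\<lambda>i j. - z i j"]) (auto simp: sum_negf)
  ultimately show ?thesis by linarith
qed

text \<open>A transversal of \<open>m\<close> consecutive intervals of length \<open>k\<close>
  starting at \<open>z\<close>, provided that \<open>c i < k\<close>. Hidden sets use arbitrary
  \<open>c\<close>; the constant choices partition the whole interval and serve for the base
  packing.\<close>

definition slice :: "nat \<Rightarrow> nat \<Rightarrow> nat \<Rightarrow> (nat \<Rightarrow> nat) \<Rightarrow> nat set" where
  "slice z k m c = (\<lambda>i. z + i * k + c i) ` {..<m}"

lemma block_bound: "i < m \<Longrightarrow> j < k \<Longrightarrow> i * k + j < m * (k::nat)"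
proof -
  assume "i < m" "j < k"
  then have "i * k + j < Suc i * k" by simp
  also have "\<dots> \<le> m * k" using \<open>i < m\<close> by (intro mult_right_mono) auto
  finally show ?thesis .
qed

lemma slice_subset:
  assumes "\<And>i. i < m \<Longrightarrow> c i < k" shows "slice z k m c \<subseteq> {z..<z + m * k}"
  using assms block_bound by (force simp: slice_def)

lemma inj_on_slice:
  fixes z k m :: nat
  assumes "\<And>i. i < m \<Longrightarrow> c i < k" shows "inj_on (\<lambda>i. z + i * k + c i) {..<m}"
proof (rule inj_onI)
  fix i j assume ij: "i \<in> {..<m}" "j \<in> {..<m}" "z + i * k + c i = z + j * k + c j"
  then have "(i * k + c i) div k = (j * k + c j) div k" by (simp only: add.assoc add_left_cancel)
  moreover have "(x * k + c x) div k = x" if "x < m" for x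
    using assms[OF that] by simp
  then have "(i * k + c i) div k = i" "(j * k + c j) div k = j" using ij by blast+
  ultimately show "i = j" by simp
qed

lemma card_slice:
  assumes "\<And>i. i < m \<Longrightarrow> c i < k" shows "card (slice z k m c) = m"
  unfolding slice_def using card_image[OF inj_on_slice[OF assms]] by simp

lemma card_Int_eq_sum: "finite K \<Longrightarrow> real (card (S \<inter> K)) = (\<Sum>e\<in>K. of_bool (e \<in> S))"
  using sum.inter_restrict[of K "\<lambda>_. 1 :: real" S] by (simp add: Int_commute of_bool_def)

lemma card_Int_slice:
  assumes "\<And>i. i < m \<Longrightarrow> c i < k"
  shows "real (card (S \<inter> slice z k m c)) = (\<Sum>i<m. of_bool (z + i * k + c i \<in> S))"
proof -
  have "real (card (S \<inter> slice z k m c)) = (\<Sum>e\<in>slice z k m c. of_bool (e \<in> S))"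
    by (rule card_Int_eq_sum) (simp add: slice_def)
  also have "\<dots> = (\<Sum>i<m. of_bool (z + i * k + c i \<in> S))"
    unfolding slice_def using sum.reindex[OF inj_on_slice, of m c k "\<lambda>e. of_bool (e \<in> S) :: real" z] assms
    by (simp only: o_def)
  finally show ?thesis .
qed

lemma card_Int_interval:
  fixes z k m :: nat
  shows "real (card (S \<inter> {z..<z + m * k})) = (\<Sum>i<m. \<Sum>j<k. of_bool (z + i * k + j \<in> S))"
proof -
  have "real (card (S \<inter> {z..<z + m * k})) = (\<Sum>e\<in>{z..<z + m * k}. of_bool (e \<in> S))"
    by (rule card_Int_eq_sum) simp
  also have "\<dots> = (\<Sum>x<m * k. of_bool (z + x \<in> S))"
    by (rule sum.reindex_bij_witness[where i = "\<lambda>x. z + x" and j = "\<lambda>x. x - z"]) auto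
  also have "\<dots> = (\<Sum>i<m. \<Sum>x\<in>{i * k..<i * k + k}. of_bool (z + x \<in> S))"
    by (rule sum.nat_group[symmetric])
  also have "\<dots> = (\<Sum>i<m. \<Sum>j<k. of_bool (z + i * k + j \<in> S))"
  proof (rule sum.cong[OF refl])
    fix i
    show "(\<Sum>x\<in>{i * k..<i * k + k}. of_bool (z + x \<in> S)) = (\<Sum>j<k. of_bool (z + i * k + j \<in> S) :: real)"
      by (rule sum.reindex_bij_witness[where i = "\<lambda>x. i * k + x" and j = "\<lambda>x. x - i * k"])
        (auto simp: add.assoc)
  qed
  finally show ?thesis .
qed

lemma UN_slices: "(\<Union>j<k. slice z k m (\<lambda>_. j)) = {z..<z + m * k}"
proof (intro equalityI subsetI)
  fix e assume "e \<in> (\<Union>j<k. slice z k m (\<lambda>_. j))"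
  then show "e \<in> {z..<z + m * k}" using slice_subset[of m "\<lambda>_. _" k z] by fastforce
next
  fix e assume e: "e \<in> {z..<z + m * k}"
  define x where "x = e - z"
  have x: "e = z + x" "x < m * k" using e by (auto simp: x_def)
  then have k: "0 < k" by (cases k) auto
  have "e = z + (x div k) * k + x mod k" using x by simp
  moreover have "x div k < m" using x by (simp add: less_mult_imp_div_less)
  ultimately show "e \<in> (\<Union>j<k. slice z k m (\<lambda>_. j))"
    using k by (auto simp: slice_def intro!: bexI[of _ "x mod k"] image_eqI[of _ _ "x div k"])
qed

lemma disjoint_slices: "disjoint_family_on (\<lambda>j. slice z k m (\<lambda>_. j)) {..<k}"
  unfolding disjoint_family_on_def
proof (intro ballI impI)
  fix i j assume ij: "i \<in> {..<k}" "j \<in> {..<k}" "i \<noteq> j"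
  show "slice z k m (\<lambda>_. i) \<inter> slice z k m (\<lambda>_. j) = {}"
  proof (rule ccontr)
    assume "slice z k m (\<lambda>_. i) \<inter> slice z k m (\<lambda>_. j) \<noteq> {}"
    then obtain u v where "z + u * k + i = z + v * k + j" by (auto simp: slice_def)
    then have "(u * k + i) mod k = (v * k + j) mod k" by simp
    then show False using ij by simp
  qed
qed

text \<open>\<open>S\<close> may be distributed unevenly among the blocks. Centering each indicator
  at the mean of its own block gives block sums 0, and the block means add up to the overall count
  divided by \<open>k\<close>.\<close>

lemma slice_concentration:
  assumes k: "0 < k" and \<eta>: "0 \<le> \<eta>" "\<eta> \<le> 1"
  shows "real (card {c \<in> {..<m} \<rightarrow>\<^sub>E {..<k}. \<eta> * real m <
      \<bar>real (card (S \<inter> slice z k m c)) - real (card (S \<inter> {z..<z + m * k})) / real k\<bar>})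
    \<le> 2 * exp (- (\<eta>\<^sup>2 * real m / 4)) * real k ^ m"
proof -
  define x where "x i j = (of_bool (z + i * k + j \<in> S) :: real)" for i j
  define \<mu> where "\<mu> i = (\<Sum>j<k. x i j) / real k" for i
  have x01: "0 \<le> x i j" "x i j \<le> 1" for i j by (auto simp: x_def)
  have \<mu>01: "0 \<le> \<mu> i" "\<mu> i \<le> 1" for i
  proof -
    show "0 \<le> \<mu> i" unfolding \<mu>_def using x01 by (intro divide_nonneg_nonneg sum_nonneg) auto
    have "(\<Sum>j<k. x i j) \<le> (\<Sum>j<k. 1)" using x01 by (intro sum_mono)
    then show "\<mu> i \<le> 1" using k by (simp add: \<mu>_def divide_le_eq)
  qed
  have "{c \<in> {..<m} \<rightarrow>\<^sub>E {..<k}. \<eta> * real m <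
      \<bar>real (card (S \<inter> slice z k m c)) - real (card (S \<inter> {z..<z + m * k})) / real k\<bar>}
    = {c \<in> {..<m} \<rightarrow>\<^sub>E {..<k}. \<eta> * real m < \<bar>\<Sum>i<m. x i (c i) - \<mu> i\<bar>}"
  proof (rule Collect_cong, rule conj_cong[OF refl])
    fix c assume "c \<in> {..<m} \<rightarrow>\<^sub>E {..<k}"
    then have "real (card (S \<inter> slice z k m c)) = (\<Sum>i<m. x i (c i))"
      unfolding x_def by (intro card_Int_slice) auto
    moreover have "real (card (S \<inter> {z..<z + m * k})) / real k = (\<Sum>i<m. \<mu> i)"
      unfolding card_Int_interval \<mu>_def x_def sum_divide_distrib ..
    ultimately show "\<eta> * real m < \<bar>real (card (S \<inter> slice z k m c)) - real (card (S \<inter> {z..<z + m * k})) / real k\<bar>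
        \<longleftrightarrow> \<eta> * real m < \<bar>\<Sum>i<m. x i (c i) - \<mu> i\<bar>"
      by (simp add: sum_subtractf)
  qed
  moreover have "real (card {c \<in> {..<m} \<rightarrow>\<^sub>E {..<k}. \<eta> * real m < \<bar>\<Sum>i<m. x i (c i) - \<mu> i\<bar>})
     \<le> 2 * exp (- (\<eta>\<^sup>2 * real m / 4)) * real k ^ m"
  proof (rule chernoff_blocks_abs[where z = "\<lambda>i j. x i j - \<mu> i"])
    show "(\<Sum>j<k. x i j - \<mu> i) = 0" for i using k by (simp add: sum_subtractf \<mu>_def)
    show "\<bar>x i j - \<mu> i\<bar> \<le> 1" for i j using x01[of i j] \<mu>01[of i] by linarith
  qed (use \<eta> in auto)
  ultimately show ?thesis by simp
qed

section \<open>The symmetric function and discrete submodularity on the box\<close>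

context symmetry_gap
begin

definition flat :: "real \<Rightarrow> real \<Rightarrow> real \<Rightarrow> real \<Rightarrow> real" where
  "flat p q b c = G (massA p q) (freeB b c) + slack (p + q + b + c)"

text \<open>Common to \<open>blend\<close> and \<open>flat\<close>, so that validity of both kinds
  of instances is proved once. The step \<open>h\<close> stays free because it becomes
  \<open>1 / real m\<close>, with \<open>m\<close> not fixed yet.\<close>

definition box_submodular :: "(real \<Rightarrow> real \<Rightarrow> real \<Rightarrow> real \<Rightarrow> real) \<Rightarrow> bool" where
  "box_submodular \<phi> \<longleftrightarrow> (\<forall>p q b c h d1 d2 d3 d4 e1 e2 e3 e4.
     box p q b c \<longrightarrow>
     box (p + h * d1 + h * e1) (q + h * d2 + h * e2) (b + h * d3 + h * e3) (c + h * d4 + h * e4) \<longrightarrow>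
     unit_vec d1 d2 d3 d4 \<longrightarrow> unit_vec e1 e2 e3 e4 \<longrightarrow> 0 \<le> h \<longrightarrow>
     \<phi> (p + h * d1 + h * e1) (q + h * d2 + h * e2) (b + h * d3 + h * e3) (c + h * d4 + h * e4) + \<phi> p q b c
       \<le> \<phi> (p + h * d1) (q + h * d2) (b + h * d3) (c + h * d4)
         + \<phi> (p + h * e1) (q + h * e2) (b + h * e3) (c + h * e4))"

lemma box_submodular_blend: "box_submodular blend"
  unfolding box_submodular_def using blend_second_difference by blast

text \<open>The part of \<open>G\<close> linear in \<open>z\<close> cancels, and the remaining
  difference is exactly a sum of three terms of known sign, each a product of increments
  \<open>1 - exp (- y1)\<close>, \<open>1 - exp (- y2)\<close> with \<open>z\<close>,
  \<open>z1\<close> or \<open>z2\<close>.\<close>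

lemma G_second_difference:
  assumes "0 \<le> z" "0 \<le> y1" "0 \<le> y2" "z1 \<le> 0" "z2 \<le> 0"
  shows "G (y + y1 + y2) (z + z1 + z2) + G y z \<le> G (y + y1) (z + z1) + G (y + y2) (z + z2)"
proof -
  have exps: "exp (- (y + y1)) = exp (- y) * exp (- y1)" "exp (- (y + y2)) = exp (- y) * exp (- y2)"
    "exp (- (y + y1 + y2)) = exp (- y) * exp (- y1) * exp (- y2)"
    by (simp_all add: exp_add[symmetric])
  have "0 \<le> z * exp (- y) * ((1 - exp (- y1)) * (1 - exp (- y2)))"
    using assms by (intro mult_nonneg_nonneg) auto
  moreover have "z1 * (exp (- y) * exp (- y1) * (1 - exp (- y2))) \<le> 0"
    "z2 * (exp (- y) * exp (- y2) * (1 - exp (- y1))) \<le> 0"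
    using assms by (auto intro!: mult_nonpos_nonneg)
  ultimately show ?thesis unfolding G_def exps by (simp add: algebra_simps)
qed

lemma slack_second_difference:
  assumes "0 \<le> s1" "0 \<le> s2"
  shows "slack (s + s1 + s2) + slack s \<le> slack (s + s1) + slack (s + s2)"
proof -
  have "slack (s + s1 + s2) + slack s = slack (s + s1) + slack (s + s2) - 800 / \<Lambda> * (s1 * s2)"
    by (simp add: slack_def algebra_simps power2_eq_square add_divide_distrib diff_divide_distrib)
  moreover have "0 \<le> 800 / \<Lambda> * (s1 * s2)" using assms \<Lambda>_ge1 by simp
  ultimately show ?thesis by linarith
qed

lemma box_submodular_flat: "box_submodular flat"
  unfolding box_submodular_def
proof (intro allI impI)
  fix p q b c h d1 d2 d3 d4 e1 e2 e3 e4
  assume bx: "box p q b c" and d: "unit_vec d1 d2 d3 d4" and e: "unit_vec e1 e2 e3 e4" and h: "0 \<le> (h::real)"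
  have nn: "0 \<le> d1 + d2" "0 \<le> d3 + d4" "0 \<le> e1 + e2" "0 \<le> e3 + e4"
    using d e by (auto simp: unit_vec_def)
  have mass: "massA (p + u) (q + v) = massA p q + a * (u + v)" for p q u v
    by (simp add: massA_def algebra_simps)
  have free: "freeB (p + u) (q + v) = freeB p q + - (u + v) / real l" for p q u v
    by (simp add: freeB_def add_divide_distrib diff_divide_distrib)
  have hn: "0 \<le> h * d1 + h * d2" "0 \<le> h * d3 + h * d4" "0 \<le> h * e1 + h * e2" "0 \<le> h * e3 + h * e4"
    using h nn by (auto simp: distrib_left[symmetric])
  have "G (massA (p + h * d1 + h * e1) (q + h * d2 + h * e2)) (freeB (b + h * d3 + h * e3) (c + h * d4 + h * e4))
      + G (massA p q) (freeB b c)
    \<le> G (massA (p + h * d1) (q + h * d2)) (freeB (b + h * d3) (c + h * d4))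
      + G (massA (p + h * e1) (q + h * e2)) (freeB (b + h * e3) (c + h * e4))"
    unfolding mass free using box_bounds[OF bx] a_pos hn l_pos
    by (intro G_second_difference) (auto simp: divide_le_0_iff)
  moreover have "slack (p + q + b + c + (h * d1 + h * d2 + h * d3 + h * d4) + (h * e1 + h * e2 + h * e3 + h * e4))
      + slack (p + q + b + c)
    \<le> slack (p + q + b + c + (h * d1 + h * d2 + h * d3 + h * d4))
      + slack (p + q + b + c + (h * e1 + h * e2 + h * e3 + h * e4))"
    using hn by (intro slack_second_difference) linarith+
  ultimately show "flat (p + h * d1 + h * e1) (q + h * d2 + h * e2) (b + h * d3 + h * e3) (c + h * d4 + h * e4) + flat p q b c
       \<le> flat (p + h * d1) (q + h * d2) (b + h * d3) (c + h * d4)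
         + flat (p + h * e1) (q + h * e2) (b + h * e3) (c + h * e4)"
    unfolding flat_def by (simp add: add_ac)
qed

lemma flat_nonneg: "box p q b c \<Longrightarrow> 0 \<le> flat p q b c"
  unfolding flat_def using G_bounds(1) slack_bounds(1) by (intro add_nonneg_nonneg) auto

end

section \<open>The hidden instances\<close>

locale gap_instance = symmetry_gap +
  fixes m :: nat
  assumes m_pos: "1 \<le> m" and \<Lambda>_large: "400 * (real R + real l)\<^sup>2 \<le> \<Lambda>"
begin

definition A :: "nat set" where "A = {0..<0 + m * R}"
definition B :: "nat set" where "B = {m * R..<m * R + m * l}"
definition C :: "(nat \<Rightarrow> nat) \<Rightarrow> nat set" where "C = slice 0 R m"
definition D :: "(nat \<Rightarrow> nat) \<Rightarrow> nat set" where "D = slice (m * R) l m"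
definition hidden :: "((nat \<Rightarrow> nat) \<times> (nat \<Rightarrow> nat)) set" where
  "hidden = ({..<m} \<rightarrow>\<^sub>E {..<R}) \<times> ({..<m} \<rightarrow>\<^sub>E {..<l})"
definition density :: "nat set \<Rightarrow> nat set \<Rightarrow> real" where
  "density S K = real (card (S \<inter> K)) / real m"
definition lift :: "(real \<Rightarrow> real \<Rightarrow> real \<Rightarrow> real \<Rightarrow> real) \<Rightarrow> (nat \<Rightarrow> nat) \<times> (nat \<Rightarrow> nat) \<Rightarrow> nat set \<Rightarrow> real" where
  "lift \<phi> \<omega> S = \<phi> (density S (C (fst \<omega>))) (density S (A - C (fst \<omega>)))
     (density S (D (snd \<omega>))) (density S (B - D (snd \<omega>)))"
text \<open>It depends on A and B but not on the hidden pair, so giving the matroid to the algorithm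
  reveals nothing about \<open>C\<close> and \<open>D\<close>.\<close>

definition constraint :: "nat set set" where
  "constraint = two_block_indep A m B ((l - 1) * m)"
definition gap_inst :: "(nat set \<Rightarrow> real) \<Rightarrow> inst" where
  "gap_inst f = \<lparr>ground = A \<union> B, indep = constraint, objective = f\<rparr>"
definition sym_objective :: "nat set \<Rightarrow> real" where
  "sym_objective S = G (a * density S A) (1 - density S B / real l) + slack (density S A + density S B)"

lemma fin: "finite A" "finite B" and disj: "A \<inter> B = {}"
  by (auto simp: A_def B_def)

lemma card_AB: "card A = m * R" "card B = m * l"
  by (simp_all add: A_def B_def)

lemma card_ground: "card (A \<union> B) = m * (R + l)"
  using card_Un_disjoint[OF fin disj] card_AB by (simp add: algebra_simps)

lemma R_ge: "l \<le> R" "1 \<le> R" using l_le_R l_ge2 by auto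

lemma hidden_slices:
  assumes "\<omega> \<in> hidden"
  shows "C (fst \<omega>) \<subseteq> A" "D (snd \<omega>) \<subseteq> B" "card (C (fst \<omega>)) = m" "card (D (snd \<omega>)) = m"
    "card (A - C (fst \<omega>)) = m * (R - 1)" "card (B - D (snd \<omega>)) = m * (l - 1)"
proof -
  have c: "\<And>i. i < m \<Longrightarrow> fst \<omega> i < R" "\<And>i. i < m \<Longrightarrow> snd \<omega> i < l"
  proof -
    have "fst \<omega> \<in> {..<m} \<rightarrow>\<^sub>E {..<R}" "snd \<omega> \<in> {..<m} \<rightarrow>\<^sub>E {..<l}"
      using assms unfolding hidden_def mem_Times_iff by blast+
    then show "\<And>i. i < m \<Longrightarrow> fst \<omega> i < R" "\<And>i. i < m \<Longrightarrow> snd \<omega> i < l"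
      using PiE_mem by (metis lessThan_iff)+
  qed
  show sub: "C (fst \<omega>) \<subseteq> A" "D (snd \<omega>) \<subseteq> B"
    unfolding C_def D_def A_def B_def using slice_subset[of m "fst \<omega>" R 0] slice_subset[of m "snd \<omega>" l "m * R"] c by blast+
  show card: "card (C (fst \<omega>)) = m" "card (D (snd \<omega>)) = m"
    unfolding C_def D_def using card_slice[of m "fst \<omega>" R 0] card_slice[of m "snd \<omega>" l "m * R"] c by blast+
  show "card (A - C (fst \<omega>)) = m * (R - 1)"
    using card_Diff_subset[OF finite_subset[OF sub(1) fin(1)] sub(1)] card card_AB by (simp add: diff_mult_distrib2)
  show "card (B - D (snd \<omega>)) = m * (l - 1)"
    using card_Diff_subset[OF finite_subset[OF sub(2) fin(2)] sub(2)] card card_AB by (simp add: diff_mult_distrib2)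
qed

lemma finite_hidden: "finite hidden"
  unfolding hidden_def by (intro finite_cartesian_product finite_PiE) auto

lemma card_hidden: "real (card hidden) = real R ^ m * real l ^ m"
  unfolding hidden_def by (simp add: card_cartesian_product card_PiE)

lemma card_hidden_pos: "0 < real (card hidden)"
  unfolding card_hidden using R_pos l_pos by simp

lemma density_nonneg: "0 \<le> density S K"
  by (simp add: density_def)

lemma density_le:
  assumes "finite K" "card K = m * k" shows "density S K \<le> real k"
proof -
  have "card (S \<inter> K) \<le> m * k" using assms card_mono[of K "S \<inter> K"] by simp
  then have "real (card (S \<inter> K)) \<le> real m * real k" by (metis of_nat_le_iff of_nat_mult)
  then show ?thesis using m_pos by (simp add: density_def divide_le_eq mult.commute)
qed

lemma density_split:
  assumes "K' \<subseteq> K" "finite K" shows "density S K = density S K' + density S (K - K')"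
proof -
  have "S \<inter> K = (S \<inter> K') \<union> (S \<inter> (K - K'))" using assms by blast
  moreover have "card ((S \<inter> K') \<union> (S \<inter> (K - K'))) = card (S \<inter> K') + card (S \<inter> (K - K'))"
    using assms finite_subset by (intro card_Un_disjoint) auto
  ultimately show ?thesis by (simp add: density_def add_divide_distrib)
qed

lemma density_insert:
  assumes "e \<notin> S" "finite K" shows "density (insert e S) K = density S K + 1 / real m * indicator K e"
  using assms by (auto simp: density_def indicator_def add_divide_distrib)

lemma density_box:
  assumes "\<omega> \<in> hidden"
  shows "box (density S (C (fst \<omega>))) (density S (A - C (fst \<omega>))) (density S (D (snd \<omega>))) (density S (B - D (snd \<omega>)))"
proof -
  note h = hidden_slices[OF assms]
  have "finite (C (fst \<omega>))" "finite (D (snd \<omega>))" using h fin finite_subset by blast+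
  then show ?thesis unfolding box_def
    using density_le[of "C (fst \<omega>)" 1 S] density_le[of "A - C (fst \<omega>)" "R - 1" S]
      density_le[of "D (snd \<omega>)" 1 S] density_le[of "B - D (snd \<omega>)" "l - 1" S] h fin density_nonneg R_ge l_ge2
    by (auto simp: of_nat_diff)
qed

text \<open>Each ground element lies in exactly one of C, A - C, D and B - D, so inserting it moves
  the density vector by \<open>1 / real m\<close> along a unit vector. Pairs of elements thus become
  the second differences of \<open>box_submodular\<close>.\<close>

lemma submodular_lift:
  assumes \<phi>: "box_submodular \<phi>" and \<omega>: "\<omega> \<in> hidden"
  shows "submodular_on (A \<union> B) (lift \<phi> \<omega>)"
proof (rule submodular_on_local)
  show "finite (A \<union> B)" using fin by simp
  note h = hidden_slices[OF \<omega>]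
  let ?K1 = "C (fst \<omega>)" and ?K2 = "A - C (fst \<omega>)" and ?K3 = "D (snd \<omega>)" and ?K4 = "B - D (snd \<omega>)"
  have fK: "finite ?K1" "finite ?K2" "finite ?K3" "finite ?K4" using h fin finite_subset by auto
  fix S e e' assume S: "S \<subseteq> A \<union> B" "e \<in> A \<union> B - S" "e' \<in> A \<union> B - S" "e \<noteq> e'"
  have unit: "unit_vec (indicator ?K1 x) (indicator ?K2 x) (indicator ?K3 x) (indicator ?K4 x)"
    if "x \<in> A \<union> B" for x
    using that h disj by (auto simp: unit_vec_def indicator_def)
  have nin: "e \<notin> S" "e' \<notin> S" "e \<notin> insert e' S" using S by auto
  note ins = density_insert[OF nin(1)] density_insert[OF nin(2)] density_insert[OF nin(3)]
  show "lift \<phi> \<omega> (insert e (insert e' S)) + lift \<phi> \<omega> S \<le> lift \<phi> \<omega> (insert e S) + lift \<phi> \<omega> (insert e' S)"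
  proof -
    have "box (density (insert e (insert e' S)) ?K1) (density (insert e (insert e' S)) ?K2)
       (density (insert e (insert e' S)) ?K3) (density (insert e (insert e' S)) ?K4)"
      by (rule density_box[OF \<omega>])
    note bx = this[unfolded ins(3)[OF fK(1)] ins(3)[OF fK(2)] ins(3)[OF fK(3)] ins(3)[OF fK(4)]
        ins(2)[OF fK(1)] ins(2)[OF fK(2)] ins(2)[OF fK(3)] ins(2)[OF fK(4)]]
    have e: "e \<in> A \<union> B" "e' \<in> A \<union> B" using S by auto
    have h0: "0 \<le> 1 / real m" by simp
    show ?thesis
      using \<phi>[unfolded box_submodular_def, rule_format, OF density_box[OF \<omega>] bx unit[OF e(2)] unit[OF e(1)] h0]
      unfolding lift_def ins(3)[OF fK(1)] ins(3)[OF fK(2)] ins(3)[OF fK(3)] ins(3)[OF fK(4)]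
        ins(2)[OF fK(1)] ins(2)[OF fK(2)] ins(2)[OF fK(3)] ins(2)[OF fK(4)]
        ins(1)[OF fK(1)] ins(1)[OF fK(2)] ins(1)[OF fK(3)] ins(1)[OF fK(4)]
      by linarith
  qed
qed

lemma packing_number: "fractional_base_packing_number (A \<union> B) (bases constraint) (real l / (real l - 1))"
  unfolding constraint_def
\<comment> \<open>The \<open>l\<close> constant slices of B exhaust it; from A, which has
  \<open>R \<ge> l\<close> of them, the first \<open>l\<close> are taken.\<close>
proof (rule packing_number_two_block[OF fin disj l_ge2 m_pos,
      where U = "\<lambda>j. slice 0 R m (\<lambda>_. j)" and W = "\<lambda>j. slice (m * R) l m (\<lambda>_. j)"])
  show "slice 0 R m (\<lambda>_. j) \<subseteq> A" if "j < l" for j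
    unfolding A_def using that R_ge by (intro slice_subset) auto
  show "card (slice 0 R m (\<lambda>_. j)) = m" if "j < l" for j
    using that R_ge by (intro card_slice) auto
  show "disjoint_family_on (\<lambda>j. slice 0 R m (\<lambda>_. j)) {..<l}"
    by (rule disjoint_family_on_mono[OF _ disjoint_slices]) (use R_ge in auto)
  show "card (slice (m * R) l m (\<lambda>_. j)) = m" if "j < l" for j
    using that by (intro card_slice) auto
  show "disjoint_family_on (\<lambda>j. slice (m * R) l m (\<lambda>_. j)) {..<l}" by (rule disjoint_slices)
  show "(\<Union>j<l. slice (m * R) l m (\<lambda>_. j)) = B" unfolding B_def by (rule UN_slices)
qed

lemma valid_gap_inst:
  assumes \<phi>: "box_submodular \<phi>" "\<And>p q b c. box p q b c \<Longrightarrow> 0 \<le> \<phi> p q b c" and \<omega>: "\<omega> \<in> hidden"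
  shows "valid_instance (real l / (real l - 1)) (gap_inst (lift \<phi> \<omega>))"
  unfolding valid_instance_def gap_inst_def
  using matroid_two_block[OF fin disj] packing_number submodular_lift[OF \<phi>(1) \<omega>] \<phi>(2)[OF density_box[OF \<omega>]]
  by (simp add: constraint_def lift_def)

lemma lift_flat:
  assumes "\<omega> \<in> hidden" shows "lift flat \<omega> = sym_objective"
proof
  fix S
  have "density S A = density S (C (fst \<omega>)) + density S (A - C (fst \<omega>))"
    "density S B = density S (D (snd \<omega>)) + density S (B - D (snd \<omega>))"
    using hidden_slices[OF assms] fin by (auto intro!: density_split)
  then show "lift flat \<omega> S = sym_objective S"
    by (simp add: lift_def flat_def sym_objective_def massA_def freeB_def add_ac)
qed

definition constraint_bases :: "nat set set" where
  "constraint_bases = {S. S \<subseteq> A \<union> B \<and> card (S \<inter> A) = m \<and> card (S \<inter> B) = (l - 1) * m}"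

lemma bases_constraint: "bases constraint = constraint_bases"
  unfolding constraint_def constraint_bases_def using R_ge card_AB l_ge2
  by (intro bases_two_block fin disj) (auto simp: mult.commute)

text \<open>All bases have density 1 in A and \<open>l - 1\<close> in B, hence the same symmetric
  value: no base beats any other.\<close>

lemma sym_objective_base:
  assumes "S \<in> bases constraint"
  shows "sym_objective S \<le> (1 - exp (- 1 / real l)) / real l + 400 / \<Lambda> * (real R + real l)\<^sup>2"
proof -
  have "card (S \<inter> A) = m" "card (S \<inter> B) = (l - 1) * m" using assms by (auto simp: bases_constraint constraint_bases_def)
  then have d: "density S A = 1" "density S B = real l - 1"
    using m_pos l_ge2 by (auto simp: density_def of_nat_diff)
  have "1 - (real l - 1) / real l = 1 / real l" using l_pos by (simp add: field_simps)
  moreover have "G a (1 / real l) \<le> (1 - exp (- 1 / real l)) / real l"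
    using a_le l_pos by (auto simp: G_def divide_right_mono)
  moreover have "slack (1 + (real l - 1)) \<le> 400 / \<Lambda> * (real R + real l)\<^sup>2"
    unfolding slack_def using \<Lambda>_ge1 by (intro mult_left_mono) auto
  ultimately show ?thesis unfolding sym_objective_def d by simp
qed

text \<open>\<open>\<Lambda>_large\<close> makes the slack at most 1. The uniform bound 2 limits
  what an exceptional hidden pair can contribute to an average and gives integrability.\<close>

lemma lift_blend_le2:
  assumes "\<omega> \<in> hidden" shows "lift blend \<omega> S \<le> 2" "0 \<le> lift blend \<omega> S"
proof -
  have "400 / \<Lambda> * (real R + real l)\<^sup>2 \<le> 1" using \<Lambda>_large \<Lambda>_ge1 by (simp add: divide_le_eq)
  then show "lift blend \<omega> S \<le> 2" unfolding lift_def using blend_le[OF density_box[OF assms]] by (smt (verit))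
  show "0 \<le> lift blend \<omega> S" unfolding lift_def by (rule blend_nonneg[OF density_box[OF assms]])
qed

text \<open>The arguments are the densities of \<open>C\<close> together with \<open>B - D\<close>.
  There F is at least P, since exp (P - y) \<le> 1 and P \<le> 1 / l, and P is at least (1 -
  \<theta>)^2 / l. As V = 1 - 1 / l \<ge> 1 / 2, the squared distance is at least 1/8, whose
  logarithm exceeds -3; Bernoulli's inequality for the cube then gives the loss 9 /
  \<Lambda>.\<close>

lemma blend_opt: "(1 - 9 / \<Lambda> - 2 * \<theta>) / real l \<le> blend 1 0 0 (real l - 1)"
proof -
  have bx: "box 1 0 0 (real l - 1)" using R_ge l_ge2 by (auto simp: box_def)
  have "1 * 1 \<le> (real R + real l)\<^sup>2" using R_ge l_ge2 unfolding power2_eq_square by (intro mult_mono) auto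
  then have \<Lambda>3: "400 \<le> \<Lambda>" using \<Lambda>_large by linarith
  have free: "freeB 0 (real l - 1) = 1 / real l" using l_pos by (simp add: freeB_def field_simps)
  have dev: "devA 1 0 = a * (1 - 1 / real R)" by (simp add: devA_def)
  have R2: "1 / real R \<le> \<theta>"
  proof -
    have "\<theta> / real l \<le> \<theta>" using \<theta>_pos l_ge2 by (simp add: divide_le_eq)
    then show ?thesis using theta_delta R_pos by (smt (verit) divide_right_mono)
  qed
  have F: "devA 1 0 \<le> F 1 0 0 (real l - 1)"
  proof -
    have "devA 1 0 \<le> 1 / real l" using box_bounds(1)[OF bx] a_le by linarith
    moreover have "exp (devA 1 0 - massA 1 0) \<le> 1" using box_bounds(5)[OF bx] by simp
    ultimately have "exp (devA 1 0 - massA 1 0) * (1 / real l - devA 1 0) \<le> 1 * (1 / real l - devA 1 0)"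
      by (intro mult_right_mono) auto
    then show ?thesis by (simp add: F_def free)
  qed
  have "(1 - \<theta>) * ((1 - \<theta>) / real l) \<le> (1 - 1 / real R) * a"
    unfolding a_def using R2 \<theta>_less1 l_pos by (intro mult_right_mono) auto
  then have F2: "(1 - \<theta>)\<^sup>2 / real l \<le> F 1 0 0 (real l - 1)"
    using F unfolding dev by (simp add: power2_eq_square mult.commute)
  have cut: "1 - 9 / \<Lambda> \<le> cutoff (dist2 1 0 0 (real l - 1))"
  proof -
    have "1 / 2 \<le> 1 - 1 / real l" using l_ge2 by (simp add: field_simps)
    then have "(1 / 2)\<^sup>2 \<le> (1 - 1 / real l)\<^sup>2" by (intro power_mono) auto
    then have "(1 / 8 :: real) \<le> dist2 1 0 0 (real l - 1)"
    proof -
      have "(1 / 2)\<^sup>2 = (1 / 4 :: real)" by (simp add: power2_eq_square)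
      then have "1 / 4 \<le> (1 - 0 - 1 / real l)\<^sup>2" using \<open>(1 / 2)\<^sup>2 \<le> _\<close> by simp
      then show ?thesis
        unfolding dist2_def free using exp_gt_zero[of "- 2 * \<Lambda>"] zero_le_power2[of "devA 1 0"] by argo
    qed
    then have "ln (1 / 8 :: real) \<le> ln (dist2 1 0 0 (real l - 1))" by (intro ln_mono) auto
    moreover have "ln (1 / 8 :: real) = - (3 * ln 2)"
    proof -
      have "ln (1 / 8 :: real) = - ln (2 ^ 3)" by (simp add: ln_div)
      also have "ln (2 ^ 3 :: real) = 3 * ln 2" using ln_realpow[of 2 3] by simp
      finally show ?thesis .
    qed
    ultimately have "- 3 \<le> ln (dist2 1 0 0 (real l - 1))" using ln_2_less_1 by linarith
    then have "- 3 / \<Lambda> \<le> ln (dist2 1 0 0 (real l - 1)) / \<Lambda>" using \<Lambda>3 by (intro divide_right_mono) auto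
    moreover have "- 3 / \<Lambda> \<ge> - 1" using \<Lambda>3 by (simp add: field_simps)
    ultimately have "(1 + - 3 / \<Lambda>) ^ 3 \<le> (max 0 (1 + ln (dist2 1 0 0 (real l - 1)) / \<Lambda>)) ^ 3"
      by (intro power_mono) auto
    moreover have "1 + real 3 * (- 3 / \<Lambda>) \<le> (1 + - 3 / \<Lambda>) ^ 3"
      using \<open>- 3 / \<Lambda> \<ge> - 1\<close> by (intro Bernoulli_inequality)
    ultimately show ?thesis unfolding cutoff_def by simp
  qed
  have "(1 - 9 / \<Lambda> - 2 * \<theta>) \<le> (1 - 9 / \<Lambda>) * (1 - \<theta>)\<^sup>2"
  proof -
    have "0 \<le> \<theta>\<^sup>2 * (1 - 9 / \<Lambda>) + 9 / \<Lambda> * (2 * \<theta>)" using \<Lambda>3 \<theta>_pos by (intro add_nonneg_nonneg mult_nonneg_nonneg) auto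
    then show ?thesis by (simp add: power2_eq_square algebra_simps add_divide_distrib)
  qed
  then have "(1 - 9 / \<Lambda> - 2 * \<theta>) / real l \<le> (1 - 9 / \<Lambda>) * ((1 - \<theta>)\<^sup>2 / real l)"
    using l_pos by (simp add: divide_right_mono)
  also have "\<dots> \<le> cutoff (dist2 1 0 0 (real l - 1)) * F 1 0 0 (real l - 1)"
    using cut F2 \<Lambda>3 cutoff_bounds[OF dist2_bounds[OF bx]] by (intro mult_mono) auto
  also have "\<dots> \<le> blend 1 0 0 (real l - 1)" by (rule blend_ge[OF bx])
  finally show ?thesis .
qed

lemma opt_ge:
  assumes \<omega>: "\<omega> \<in> hidden" shows "(1 - 9 / \<Lambda> - 2 * \<theta>) / real l \<le> opt (gap_inst (lift blend \<omega>))"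
proof -
  note h = hidden_slices[OF \<omega>]
  define S where "S = C (fst \<omega>) \<union> (B - D (snd \<omega>))"
  have SA: "S \<inter> A = C (fst \<omega>)" "S \<inter> B = B - D (snd \<omega>)" using h disj by (auto simp: S_def)
  have Sb: "S \<in> bases constraint" unfolding bases_constraint constraint_bases_def
    using h SA by (auto simp: S_def mult.commute)
  have "S \<inter> C (fst \<omega>) = C (fst \<omega>)" "S \<inter> (A - C (fst \<omega>)) = {}" "S \<inter> D (snd \<omega>) = {}"
    "S \<inter> (B - D (snd \<omega>)) = B - D (snd \<omega>)"
    using h disj by (auto simp: S_def)
  then have "lift blend \<omega> S = blend 1 0 0 (real l - 1)"
    using h m_pos l_ge2 by (simp add: lift_def density_def of_nat_diff)
  moreover have "lift blend \<omega> S \<le> opt (gap_inst (lift blend \<omega>))"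
  proof -
    have "finite constraint_bases" unfolding constraint_bases_def by (rule finite_subset[of _ "Pow (A \<union> B)"]) (use fin in auto)
    then show ?thesis using Sb unfolding opt_def gap_inst_def by (auto simp: bases_constraint intro!: Max_ge)
  qed
  ultimately show ?thesis using blend_opt by linarith
qed

end

section \<open>Indistinguishability and averaging\<close>

text \<open>Agreement is needed only along the run on \<open>g\<close>: while the answers coincide,
  adaptive runs cannot branch apart. With \<open>g\<close> symmetric, the relevant sets are
  therefore fixed before the hidden pair is drawn.\<close>

lemma result_eq_of_queries_agree:
  "\<forall>S\<in>set (queries g t). f S = g S \<Longrightarrow> result f t = result g t"
  by (induction t) auto

context symmetry_gap
begin

text \<open>The largest common bound on |P| and |V| that ensures the hypothesis of
  \<open>blend_symmetric\<close>, namely (P^2 + V^2) / 2 + exp (- 2 \<Lambda>) \<le> exp (-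
  \<Lambda>).\<close>

definition \<eta> :: real where "\<eta> = sqrt (exp (- \<Lambda>) - exp (- 2 * \<Lambda>))"

lemma \<eta>: "0 < \<eta>" "\<eta> \<le> 1" "\<eta>\<^sup>2 = exp (- \<Lambda>) - exp (- 2 * \<Lambda>)"
proof -
  have pos: "0 < exp (- \<Lambda>) - exp (- 2 * \<Lambda>)" using \<Lambda>_ge1 by simp
  then show "0 < \<eta>" "\<eta>\<^sup>2 = exp (- \<Lambda>) - exp (- 2 * \<Lambda>)" by (simp_all add: \<eta>_def)
  have "exp (- \<Lambda>) \<le> 1" using \<Lambda>_ge1 by simp
  then have "exp (- \<Lambda>) - exp (- 2 * \<Lambda>) \<le> 1" using exp_gt_zero[of "- 2 * \<Lambda>"] by linarith
  then show "\<eta> \<le> 1" by (simp add: \<eta>_def)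
qed

end

section \<open>Balanced sets and averaging over the hidden pairs\<close>

context gap_instance
begin

definition balanced :: "nat set \<Rightarrow> (nat \<Rightarrow> nat) \<times> (nat \<Rightarrow> nat) \<Rightarrow> bool" where
  "balanced S \<omega> \<longleftrightarrow>
     \<bar>real (card (S \<inter> C (fst \<omega>))) - real (card (S \<inter> A)) / real R\<bar> \<le> \<eta> * real m \<and>
     \<bar>real (card (S \<inter> D (snd \<omega>))) - real (card (S \<inter> B)) / real l\<bar> \<le> \<eta> * real m"

lemma lift_blend_balanced:
  assumes \<omega>: "\<omega> \<in> hidden" and bal: "balanced S \<omega>"
  shows "lift blend \<omega> S = sym_objective S"
proof -
  let ?p = "density S (C (fst \<omega>))" and ?q = "density S (A - C (fst \<omega>))"
    and ?b = "density S (D (snd \<omega>))" and ?c = "density S (B - D (snd \<omega>))"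
  have A: "?p + ?q = density S A" and B: "?b + ?c = density S B"
    using hidden_slices[OF \<omega>] fin by (auto intro!: density_split[symmetric])
  have m0: "0 < real m" using m_pos by simp
  have "\<bar>?p - (?p + ?q) / real R\<bar> \<le> \<eta>"
  proof -
    have "?p - (?p + ?q) / real R = (real (card (S \<inter> C (fst \<omega>))) - real (card (S \<inter> A)) / real R) / real m"
      unfolding A by (simp add: density_def diff_divide_distrib)
    then show ?thesis using bal m0 by (simp add: balanced_def abs_divide pos_divide_le_eq)
  qed
  then have "\<bar>devA ?p ?q\<bar> \<le> 1 * \<eta>"
    unfolding devA_def using a_pos a_le_half by (intro abs_mult_le_mult) auto
  then have 1: "(devA ?p ?q)\<^sup>2 \<le> \<eta>\<^sup>2" using \<eta>(1) by (simp add: abs_le_square_iff[symmetric])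
  have "\<bar>1 - ?b - freeB ?b ?c\<bar> \<le> \<eta>"
  proof -
    have "1 - ?b - freeB ?b ?c = - ((real (card (S \<inter> D (snd \<omega>))) - real (card (S \<inter> B)) / real l) / real m)"
      unfolding freeB_def B by (simp add: density_def diff_divide_distrib)
    then show ?thesis using bal m0 by (simp add: balanced_def abs_divide pos_divide_le_eq)
  qed
  then have 2: "(1 - ?b - freeB ?b ?c)\<^sup>2 \<le> \<eta>\<^sup>2" using \<eta>(1) by (simp add: abs_le_square_iff[symmetric])
  have "blend ?p ?q ?b ?c = G (massA ?p ?q) (freeB ?b ?c) + slack (?p + ?q + ?b + ?c)"
    by (rule blend_symmetric) (use 1 2 \<eta>(3) in argo)
  then have "lift blend \<omega> S = lift flat \<omega> S" by (simp add: lift_def flat_def)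
  then show ?thesis by (simp add: lift_flat[OF \<omega>])
qed

definition tail :: real where "tail = exp (- (\<eta>\<^sup>2 * real m / 4))"

text \<open>A union bound: each of the two transversals contributes a two-sided deviation bound
  \<open>2 * tail\<close>, with the other transversal left free.\<close>

lemma card_unbalanced: "real (card {\<omega> \<in> hidden. \<not> balanced S \<omega>}) \<le> 4 * tail * real (card hidden)"
proof -
  let ?\<Omega>1 = "{..<m} \<rightarrow>\<^sub>E {..<R}" and ?\<Omega>2 = "{..<m} \<rightarrow>\<^sub>E {..<l}"
  define X where "X = {c \<in> ?\<Omega>1. \<eta> * real m < \<bar>real (card (S \<inter> C c)) - real (card (S \<inter> A)) / real R\<bar>}"
  define Y where "Y = {b \<in> ?\<Omega>2. \<eta> * real m < \<bar>real (card (S \<inter> D b)) - real (card (S \<inter> B)) / real l\<bar>}"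
  have \<Omega>: "finite ?\<Omega>1" "finite ?\<Omega>2" by (intro finite_PiE; simp)+
  have fXY: "finite X" "finite Y" using \<Omega> by (simp_all add: X_def Y_def)
  have sub: "{\<omega> \<in> hidden. \<not> balanced S \<omega>} \<subseteq> X \<times> ?\<Omega>2 \<union> ?\<Omega>1 \<times> Y"
  proof
    fix \<omega> assume "\<omega> \<in> {\<omega> \<in> hidden. \<not> balanced S \<omega>}"
    then show "\<omega> \<in> X \<times> ?\<Omega>2 \<union> ?\<Omega>1 \<times> Y"
      unfolding hidden_def balanced_def X_def Y_def mem_Times_iff mem_Collect_eq Un_iff not_le de_Morgan_conj by blast
  qed
  have X: "real (card X) \<le> 2 * tail * real R ^ m"
    using slice_concentration[of R \<eta> m S 0] \<eta> R_ge unfolding X_def C_def A_def tail_def by simp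
  have Y: "real (card Y) \<le> 2 * tail * real l ^ m"
    using slice_concentration[of l \<eta> m S "m * R"] \<eta> l_ge2 unfolding Y_def D_def B_def tail_def by simp
  have "card {\<omega> \<in> hidden. \<not> balanced S \<omega>} \<le> card (X \<times> ?\<Omega>2 \<union> ?\<Omega>1 \<times> Y)"
    using fXY \<Omega> by (intro card_mono[OF _ sub]) simp
  also have "\<dots> \<le> card (X \<times> ?\<Omega>2) + card (?\<Omega>1 \<times> Y)" by (rule card_Un_le)
  finally have "real (card {\<omega> \<in> hidden. \<not> balanced S \<omega>}) \<le> real (card (X \<times> ?\<Omega>2) + card (?\<Omega>1 \<times> Y))"
    by (simp only: of_nat_le_iff)
  also have "\<dots> = real (card X) * real l ^ m + real R ^ m * real (card Y)"
    by (simp add: card_cartesian_product card_PiE)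
  also have "\<dots> \<le> (2 * tail * real R ^ m) * real l ^ m + real R ^ m * (2 * tail * real l ^ m)"
    using X Y by (intro add_mono mult_right_mono mult_left_mono) auto
  also have "\<dots> = 4 * tail * real (card hidden)" by (simp add: card_hidden)
  finally show ?thesis .
qed

text \<open>Yao's principle: the tree is fixed and the hidden pair is averaged. Outside
  \<open>bad\<close> the run is the symmetric one and earns at most \<open>v\<close>; inside, the
  value is at most 2. There are at most N + 1 sets to keep balanced, whence 2 * 4 * (N + 1) *
  tail.\<close>

lemma average_value_bound:
  assumes res: "\<And>\<omega>. \<omega> \<in> hidden \<Longrightarrow> result (lift blend \<omega>) t \<in> bases constraint"
    and sym: "result sym_objective t \<in> bases constraint"
    and len: "real (length (queries sym_objective t)) \<le> N"
    and v: "\<And>S. S \<in> bases constraint \<Longrightarrow> sym_objective S \<le> v" "0 \<le> v"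
  shows "(\<Sum>\<omega>\<in>hidden. lift blend \<omega> (result (lift blend \<omega>) t)) \<le> (v + 8 * (N + 1) * tail) * real (card hidden)"
proof -
  \<comment> \<open>The output is included although it need not be queried: its hidden value must
    also coincide with the symmetric one.\<close>
  define Q where "Q = insert (result sym_objective t) (set (queries sym_objective t))"
  define bad where "bad = (\<Union>S\<in>Q. {\<omega> \<in> hidden. \<not> balanced S \<omega>})"
  have finQ: "finite Q" by (simp add: Q_def)
  have cardQ: "real (card Q) \<le> N + 1"
  proof -
    have "card Q \<le> Suc (length (queries sym_objective t))"
      unfolding Q_def using card_length[of "queries sym_objective t"] by (simp add: card_insert_if le_SucI)
    then show ?thesis using len by linarith
  qed
  have badsub: "bad \<subseteq> hidden" by (auto simp: bad_def)
  have "card bad \<le> (\<Sum>S\<in>Q. card {\<omega> \<in> hidden. \<not> balanced S \<omega>})"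
    unfolding bad_def by (rule card_UN_le[OF finQ])
  then have "real (card bad) \<le> (\<Sum>S\<in>Q. real (card {\<omega> \<in> hidden. \<not> balanced S \<omega>}))"
    unfolding of_nat_sum[symmetric] by (simp only: of_nat_le_iff)
  also have "\<dots> \<le> (\<Sum>S\<in>Q. 4 * tail * real (card hidden))" by (intro sum_mono card_unbalanced)
  also have "\<dots> = real (card Q) * (4 * tail * real (card hidden))" by simp
  also have "\<dots> \<le> (N + 1) * (4 * tail * real (card hidden))"
    using cardQ by (intro mult_right_mono) (auto simp: tail_def)
  finally have bad: "real (card bad) \<le> (N + 1) * (4 * tail * real (card hidden))" .
  have val: "lift blend \<omega> (result (lift blend \<omega>) t) \<le> v + 2 * indicator bad \<omega>" if \<omega>: "\<omega> \<in> hidden" for \<omega>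
  proof (cases "\<omega> \<in> bad")
    case True
    then show ?thesis using lift_blend_le2(1)[OF \<omega>, of "result (lift blend \<omega>) t"] v(2) by simp
  next
    case False
    then have eq: "lift blend \<omega> S = sym_objective S" if "S \<in> Q" for S
      using that \<omega> by (intro lift_blend_balanced) (auto simp: bad_def)
    then have "result (lift blend \<omega>) t = result sym_objective t"
      by (intro result_eq_of_queries_agree) (auto simp: Q_def)
    moreover have "lift blend \<omega> (result sym_objective t) = sym_objective (result sym_objective t)"
      by (rule eq) (simp add: Q_def)
    ultimately show ?thesis using v(1)[OF sym] False by simp
  qed
  have "(\<Sum>\<omega>\<in>hidden. lift blend \<omega> (result (lift blend \<omega>) t)) \<le> (\<Sum>\<omega>\<in>hidden. v + 2 * indicator bad \<omega>)"
    by (intro sum_mono val)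
  also have "\<dots> = v * real (card hidden) + 2 * (\<Sum>\<omega>\<in>hidden. indicator bad \<omega>)"
    by (simp add: sum.distrib sum_distrib_left)
  also have "(\<Sum>\<omega>\<in>hidden. indicator bad \<omega>) = real (card bad)"
    using card_Int_eq_sum[OF finite_hidden, of bad] badsub by (simp add: indicator_def Int_absorb2)
  finally show ?thesis using bad by (simp add: algebra_simps)
qed

text \<open>All instances share ground set and matroid, hence the same distribution \<mu> of trees.
  Exchanging the expectation over \<mu> with the sum over hidden pairs reduces the randomized
  guarantee to a bound for each tree in the support.\<close>

lemma approximation_gap:
  assumes alg: "approximation_algorithm \<alpha> \<F> Alg" and \<alpha>: "0 \<le> \<alpha>"
    and mem: "\<And>\<omega>. \<omega> \<in> hidden \<Longrightarrow> gap_inst (lift blend \<omega>) \<in> \<F>" "gap_inst sym_objective \<in> \<F>"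
    and few: "\<And>t. t \<in> set_pmf (run_on Alg (gap_inst sym_objective)) \<Longrightarrow>
       real (length (queries sym_objective t)) \<le> N"
    and v: "\<And>S. S \<in> bases constraint \<Longrightarrow> sym_objective S \<le> v" "0 \<le> v"
    and o: "\<And>\<omega>. \<omega> \<in> hidden \<Longrightarrow> w \<le> opt (gap_inst (lift blend \<omega>))"
  shows "\<alpha> * w \<le> v + 8 * (N + 1) * tail"
proof -
  define \<mu> where "\<mu> = Alg (A \<union> B) constraint"
  have run: "run_on Alg (gap_inst f) = \<mu>" for f by (simp add: run_on_def gap_inst_def \<mu>_def)
  have inst: "objective (gap_inst f) = f" "indep (gap_inst f) = constraint" for f
    by (simp_all add: gap_inst_def)
  define X where "X \<omega> t = lift blend \<omega> (result (lift blend \<omega>) t)" for \<omega> t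
  have alg1: "result (lift blend \<omega>) t \<in> bases constraint" if "\<omega> \<in> hidden" "t \<in> set_pmf \<mu>" for \<omega> t
    using alg mem(1)[OF that(1)] that(2) unfolding approximation_algorithm_def by (metis run inst)
  have alg2: "result sym_objective t \<in> bases constraint" if "t \<in> set_pmf \<mu>" for t
    using alg mem(2) that unfolding approximation_algorithm_def by (metis run inst)
  have alg3: "\<alpha> * opt (gap_inst (lift blend \<omega>)) \<le> measure_pmf.expectation \<mu> (X \<omega>)" if "\<omega> \<in> hidden" for \<omega>
    using alg mem(1)[OF that] unfolding approximation_algorithm_def X_def by (metis run inst)
  have int: "integrable (measure_pmf \<mu>) (X \<omega>)" if "\<omega> \<in> hidden" for \<omega>
    by (rule measure_pmf.integrable_const_bound[where B = 2])
      (use lift_blend_le2[OF that] in \<open>auto simp: X_def\<close>)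
  have "real (card hidden) * (\<alpha> * w) = (\<Sum>\<omega>\<in>hidden. \<alpha> * w)" by simp
  also have "\<dots> \<le> (\<Sum>\<omega>\<in>hidden. measure_pmf.expectation \<mu> (X \<omega>))"
  proof (rule sum_mono)
    fix \<omega> assume \<omega>: "\<omega> \<in> hidden"
    have "\<alpha> * w \<le> \<alpha> * opt (gap_inst (lift blend \<omega>))" using o[OF \<omega>] \<alpha> by (rule mult_left_mono)
    then show "\<alpha> * w \<le> measure_pmf.expectation \<mu> (X \<omega>)" using alg3[OF \<omega>] by linarith
  qed
  also have "\<dots> = measure_pmf.expectation \<mu> (\<lambda>t. \<Sum>\<omega>\<in>hidden. X \<omega> t)"
    by (rule Bochner_Integration.integral_sum[symmetric]) (rule int)
  also have "\<dots> \<le> (v + 8 * (N + 1) * tail) * real (card hidden)"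
  proof (rule measure_pmf.integral_le_const)
    show "integrable (measure_pmf \<mu>) (\<lambda>t. \<Sum>\<omega>\<in>hidden. X \<omega> t)"
      by (rule Bochner_Integration.integrable_sum) (rule int)
    show "AE t in measure_pmf \<mu>. (\<Sum>\<omega>\<in>hidden. X \<omega> t) \<le> (v + 8 * (N + 1) * tail) * real (card hidden)"
      unfolding AE_measure_pmf_iff X_def
      using alg1 alg2 few v unfolding run by (intro ballI average_value_bound) auto
  qed
  finally show ?thesis using card_hidden_pos by (simp add: mult.commute)
qed

end

section \<open>Calibration of the constants and the final family\<close>

context gap_instance
begin

text \<open>
The symmetric instance is included so that the query bound of an algorithm also applies to its run
on the symmetric objective.
\<close>

definition instances :: "inst set" where
  "instances = insert (gap_inst sym_objective) ((\<lambda>\<omega>. gap_inst (lift blend \<omega>)) ` hidden)"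

lemma valid_instances:
  assumes "I \<in> instances" shows "valid_instance (real l / (real l - 1)) I"
proof -
  have "hidden \<noteq> {}" using card_hidden_pos by auto
  then obtain \<omega> where \<omega>: "\<omega> \<in> hidden" by blast
  have "valid_instance (real l / (real l - 1)) (gap_inst sym_objective)"
    using valid_gap_inst[OF box_submodular_flat flat_nonneg \<omega>] by (simp add: lift_flat[OF \<omega>])
  moreover have "valid_instance (real l / (real l - 1)) (gap_inst (lift blend \<omega>))" if "\<omega> \<in> hidden" for \<omega>
    by (rule valid_gap_inst[OF box_submodular_blend blend_nonneg that])
  ultimately show ?thesis using assms by (auto simp: instances_def)
qed

lemma card_ground_instances: "I \<in> instances \<Longrightarrow> card (ground I) = m * (R + l)"
  by (auto simp: instances_def gap_inst_def card_ground)

text \<open>The budget in units of e / l: the guarantee exceeds the symmetric value by at least 3/4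
  - 1/4 = 1/2, after losing at most \<kappa> \<le> e / 4 in the optimum. The slack uses up 1/8 and
  the exceptional pairs less than 3/8, a contradiction.\<close>

lemma instances_need_queries:
  assumes alg: "approximation_algorithm (1 - exp (- 1 / real l) + \<epsilon>) \<F> Alg"
    and sub: "instances \<subseteq> \<F>"
    and e: "0 < e" "e \<le> 1" "e \<le> \<epsilon>" and \<theta>: "\<theta> \<le> e / 16" and \<Lambda>1: "72 / e \<le> \<Lambda>"
    and \<Lambda>2: "3200 * real l * (real R + real l)\<^sup>2 / e \<le> \<Lambda>"
    and m: "16 * exp (- (\<eta>\<^sup>2 * real m / 8)) < 3 / 8 * e / real l"
  shows "needs_queries Alg \<F> (m * (R + l)) (exp (\<eta>\<^sup>2 / (8 * (real R + real l)) * real (m * (R + l))))"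
proof (rule ccontr)
  assume neg: "\<not> ?thesis"
  have Rl: "0 < real R + real l" using R_pos l_pos by linarith
  \<comment> \<open>The exponent is half that of \<open>1 / tail\<close>, so
    \<open>q * tail = 1 / q\<close> still decays exponentially in \<open>m\<close>.\<close>
  define q where "q = exp (\<eta>\<^sup>2 * real m / 8)"
  have q: "exp (\<eta>\<^sup>2 / (8 * (real R + real l)) * real (m * (R + l))) = q"
  proof -
    have "\<eta>\<^sup>2 / (8 * (real R + real l)) * real (m * (R + l)) = \<eta>\<^sup>2 * real m / 8"
      using Rl by (simp add: divide_simps)
    then show ?thesis by (simp add: q_def)
  qed
  have q1: "1 \<le> q" by (simp add: q_def)
  have symF: "gap_inst sym_objective \<in> \<F>" using sub by (auto simp: instances_def)
  have few: "real (length (queries sym_objective t)) \<le> q"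
    if "t \<in> set_pmf (run_on Alg (gap_inst sym_objective))" for t
  proof (rule ccontr)
    assume "\<not> real (length (queries sym_objective t)) \<le> q"
    then have "needs_queries Alg \<F> (m * (R + l)) q"
      unfolding needs_queries_def using symF that
      by (intro bexI[of _ "gap_inst sym_objective"] conjI bexI[of _ t])
        (auto simp: gap_inst_def card_ground)
    then show False using neg q by simp
  qed
  define \<beta> where "\<beta> = 1 - exp (- 1 / real l)"
  define \<kappa> where "\<kappa> = 9 / \<Lambda> + 2 * \<theta>"
  define s where "s = 400 / \<Lambda> * (real R + real l)\<^sup>2"
  have \<beta>: "0 \<le> \<beta>" "\<beta> \<le> 1" using l_pos by (auto simp: \<beta>_def)
  have \<Lambda>0: "0 < \<Lambda>" using \<Lambda>_ge1 by simp
  have \<kappa>: "\<kappa> \<le> e / 4" "0 \<le> \<kappa>"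
  proof -
    have "9 / \<Lambda> \<le> e / 8" using \<Lambda>1 \<Lambda>0 e by (simp add: field_simps)
    then show "\<kappa> \<le> e / 4" using \<theta> by (simp add: \<kappa>_def)
    show "0 \<le> \<kappa>" using \<Lambda>0 \<theta>_pos by (simp add: \<kappa>_def)
  qed
  have s: "s \<le> e / (8 * real l)"
    using \<Lambda>2 \<Lambda>0 e l_pos by (simp add: s_def field_simps)
  have s0: "0 \<le> s" using \<Lambda>0 by (simp add: s_def)
  have "(\<beta> + \<epsilon>) * ((1 - \<kappa>) / real l) \<le> (\<beta> / real l + s) + 8 * (q + 1) * tail"
  proof (rule approximation_gap[OF _ _ _ symF few])
    show "approximation_algorithm (\<beta> + \<epsilon>) \<F> Alg" using alg by (simp add: \<beta>_def)
    show "0 \<le> \<beta> + \<epsilon>" using \<beta> e by linarith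
    show "gap_inst (lift blend \<omega>) \<in> \<F>" if "\<omega> \<in> hidden" for \<omega> using sub that by (auto simp: instances_def)
    show "sym_objective S \<le> \<beta> / real l + s" if "S \<in> bases constraint" for S
      using sym_objective_base[OF that] by (simp add: \<beta>_def s_def)
    show "0 \<le> \<beta> / real l + s" using \<beta> l_pos s0 by simp
    show "(1 - \<kappa>) / real l \<le> opt (gap_inst (lift blend \<omega>))" if "\<omega> \<in> hidden" for \<omega>
      using opt_ge[OF that] by (simp add: \<kappa>_def diff_diff_eq)
  qed
  moreover have "8 * (q + 1) * tail < 3 / 8 * e / real l"
  proof -
    have "8 * (q + 1) * tail \<le> 16 * q * tail" using q1 by (intro mult_right_mono) (auto simp: tail_def)
    also have "\<dots> = 16 * exp (- (\<eta>\<^sup>2 * real m / 8))"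
      by (simp add: q_def tail_def exp_add[symmetric] mult.assoc)
    finally show ?thesis using m by linarith
  qed
  moreover have "\<beta> / real l + 1 / 2 * e / real l \<le> (\<beta> + \<epsilon>) * ((1 - \<kappa>) / real l)"
  proof -
    have "e * (3 / 4) \<le> \<epsilon> * (1 - \<kappa>)" using e \<kappa> by (intro mult_mono) auto
    moreover have "\<beta> * \<kappa> \<le> 1 * (e / 4)" using \<beta> \<kappa> by (intro mult_mono) auto
    ultimately have "\<beta> + 1 / 2 * e \<le> (\<beta> + \<epsilon>) * (1 - \<kappa>)" by (simp add: algebra_simps)
    then have "(\<beta> + 1 / 2 * e) / real l \<le> (\<beta> + \<epsilon>) * (1 - \<kappa>) / real l"
      using l_pos by (intro divide_right_mono) auto
    then show ?thesis by (simp add: add_divide_distrib)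
  qed
  moreover have "e / (8 * real l) + 3 / 8 * e / real l = 1 / 2 * e / real l"
    using l_pos by (simp add: field_simps)
  ultimately show False using s by linarith
qed

end

theorem theoremE1:
  fixes l :: nat and \<epsilon> :: real
  assumes "l \<ge> 2" and "\<epsilon> > 0"
  shows "\<exists>\<F> :: inst set.
     (\<forall>I\<in>\<F>. valid_instance (real l / (real l - 1)) I) \<and>
     infinite ((\<lambda>I. card (ground I)) ` \<F>) \<and>
     (\<exists>c>0. \<forall>A. approximation_algorithm (1 - exp (- 1 / real l) + \<epsilon>) \<F> A \<longrightarrow>
        (\<forall>n \<in> (\<lambda>I. card (ground I)) ` \<F>. needs_queries A \<F> n (exp (c * real n))))"
proof -
  define e where "e = min \<epsilon> 1"
  have e: "0 < e" "e \<le> 1" "e \<le> \<epsilon>" using assms by (auto simp: e_def)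
  define \<theta> where "\<theta> = e / 16"
  define R where "R = nat \<lceil>2 * real l / \<theta>\<rceil>"
  \<comment> \<open>The first pair meets the assumptions of the two locales, \<open>72 / e\<close>
    makes the cutoff loss 9 / \<Lambda> at most e / 8, and the last entry makes the slack at most e
    / (8 l).\<close>
  define \<Lambda> where "\<Lambda> = max (max 1 (400 * (real R + real l)\<^sup>2)) (max (72 / e) (3200 * real l * (real R + real l)\<^sup>2 / e))"
  have \<theta>: "0 < \<theta>" "\<theta> < 1" using e by (auto simp: \<theta>_def)
  have R: "2 * real l \<le> \<theta> * real R"
  proof -
    have "2 * real l / \<theta> \<le> real R" unfolding R_def by linarith
    then show ?thesis using \<theta> by (simp add: field_simps)
  qed
  interpret symmetry_gap l R \<theta> \<Lambda>
    using assms \<theta> R by unfold_locales (auto simp: \<Lambda>_def)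
  define x where "x = 3 / 8 * e / real l"
  have x: "0 < x" using e l_pos by (simp add: x_def)
  \<comment> \<open>With u = \<eta>^2 m / 8, the bound 1 + u \<le> exp u reduces the claim
    \<open>small\<close> to 16 \<le> x u, that is, m \<ge> 128 / (x \<eta>^2).\<close>
  define m0 where "m0 = nat \<lceil>128 / (x * \<eta>\<^sup>2)\<rceil> + 1"
  have gi: "gap_instance l R \<theta> \<Lambda> m" if "m0 \<le> m" for m
    using that by unfold_locales (auto simp: m0_def \<Lambda>_def)
  have small: "16 * exp (- (\<eta>\<^sup>2 * real m / 8)) < x" if "m0 \<le> m" for m
  proof -
    have "128 / (x * \<eta>\<^sup>2) \<le> real m" using that unfolding m0_def by linarith
    then have "16 \<le> x * (\<eta>\<^sup>2 * real m / 8)" using x \<eta>(1) by (simp add: field_simps)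
    also have "\<dots> < x * exp (\<eta>\<^sup>2 * real m / 8)"
      using x exp_ge_add_one_self[of "\<eta>\<^sup>2 * real m / 8"] by (intro mult_strict_left_mono) linarith+
    finally show ?thesis by (simp add: exp_minus field_simps)
  qed
  \<comment> \<open>One family for all large \<open>m\<close>: none of \<open>R\<close>, \<Lambda>
    and \<eta> depends on \<open>m\<close>, so a single rate \<open>c\<close> serves every size. The
    complete set of hidden instances is present for each \<open>m\<close>, as the averaging
    requires.\<close>
  define \<F> where "\<F> = (\<Union>m\<in>{m0..}. gap_instance.instances l R \<theta> \<Lambda> m)"
  define c where "c = \<eta>\<^sup>2 / (8 * (real R + real l))"
  have card: "card (ground I) = m * (R + l)" if "m0 \<le> m" "I \<in> gap_instance.instances l R \<theta> \<Lambda> m" for I m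
    using gap_instance.card_ground_instances[OF gi[OF that(1)] that(2)] .
  have valid: "\<forall>I\<in>\<F>. valid_instance (real l / (real l - 1)) I"
    unfolding \<F>_def using gap_instance.valid_instances[OF gi] by auto
  have inf: "infinite ((\<lambda>I. card (ground I)) ` \<F>)"
  proof -
    have "m * (R + l) \<in> (\<lambda>I. card (ground I)) ` \<F>" if m: "m0 \<le> m" for m
    proof -
      obtain I where I: "I \<in> gap_instance.instances l R \<theta> \<Lambda> m"
        using gap_instance.instances_def[OF gi[OF m]] by blast
      then show ?thesis using card[OF m I] m unfolding \<F>_def by (auto intro!: image_eqI[of _ _ I])
    qed
    then have "(\<lambda>m. m * (R + l)) ` {m0..} \<subseteq> (\<lambda>I. card (ground I)) ` \<F>" by auto
    moreover have "infinite ((\<lambda>m. m * (R + l)) ` {m0..})"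
    proof
      assume "finite ((\<lambda>m. m * (R + l)) ` {m0..})"
      moreover have "inj_on (\<lambda>m. m * (R + l)) {m0..}" using assms(1) by (auto simp: inj_on_def)
      ultimately have "finite {m0..}" by (rule finite_imageD)
      then show False by (simp add: infinite_Ici)
    qed
    ultimately show ?thesis using finite_subset by blast
  qed
  have "needs_queries Alg \<F> n (exp (c * real n))"
    if alg: "approximation_algorithm (1 - exp (- 1 / real l) + \<epsilon>) \<F> Alg"
      and n: "n \<in> (\<lambda>I. card (ground I)) ` \<F>" for Alg n
  proof -
    obtain m I where m: "m0 \<le> m" "I \<in> gap_instance.instances l R \<theta> \<Lambda> m" "n = card (ground I)"
      using n unfolding \<F>_def by auto
    then have n: "n = m * (R + l)" using card by simp
    have "gap_instance.instances l R \<theta> \<Lambda> m \<subseteq> \<F>" using m unfolding \<F>_def by auto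
    then show ?thesis unfolding n c_def
      by (rule gap_instance.instances_need_queries[OF gi[OF m(1)] alg _ e])
        (use small[OF m(1)] in \<open>auto simp: \<theta>_def \<Lambda>_def x_def\<close>)
  qed
  moreover have "0 < c" using \<eta>(1) R_pos l_pos by (simp add: c_def)
  ultimately show ?thesis using valid inf by blast
qed

end
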